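(* Every symmetric function in $\mathbb Z[q]\otimes\Lambda_n$ has the form $Y_q(g)$ for some element $g\in\mathbb Q(q)\otimes H_n(q)$, where $Y_q(g)=\sum_{\lambda\vdash n}\epsilon_q^\lambda(g)m_\lambda$.
   Context: $\Lambda_n$ is the $\mathbb Z$-module of homogeneous degree-$n$ symmetric functions with integer coefficients, and $m_\lambda$ the monomial symmetric functions. $H_n(q)$ is the type $A$ Hecke algebra with generators $T_{s_1},\dots,T_{s_{n-1}}$ and relations $T_{s_i}^2=(q-1)T_{s_i}+q$, $T_{s_i}T_{s_j}=T_{s_j}T_{s_i}$ for $|i-j|\ge2$, $T_{s_i}T_{s_j}T_{s_i}=T_{s_j}T_{s_i}T_{s_j}$ for $|i-j|=1$, with natural basis $\{T_w: w\in\mathfrak S_n\}$. $\mathbb Q(q)\otimes H_n(q)$ is this algebra over $\mathbb Q(q)$ (with $\mathbb Q(q)$-basis $\{T_w\}$). $\epsilon_q^\lambda$ is the character of $H_n(q)$ induced from the sign character $T_w\mapsto(-1)^{\ell(w)}$ of the parabolic subalgebra $H_\lambda(q)$ corresponding to the Young subgroup $\mathfrak S_\lambda$, extended $\mathbb Q(q)$-linearly. *)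

theory Defs
  imports
    "HOL-Computational_Algebra.Computational_Algebra"
    "HOL-Combinatorics.Combinatorics"
begin

section \<open>Scalars\<close>

type_synonym ratq = "rat poly fract"

definition qvar :: ratq where
  "qvar = to_fract [:0, 1:]"

definition of_Zq :: "int poly \<Rightarrow> ratq" where
  "of_Zq p = to_fract (map_poly of_int p)"


section \<open>Integer partitions and symmetric functions\<close>

definition partitions :: "nat \<Rightarrow> nat list set" where
  "partitions n = {l. sorted_wrt (\<ge>) l \<and> 0 \<notin> set l \<and> sum_list l = n}"

lemma finite_partitions: "finite (partitions n)"
proof (rule finite_subset)
  have len: "length l \<le> sum_list l" if "0 \<notin> set l" for l :: "nat list"
    using that by (induction l) auto
  show "partitions n \<subseteq> {l. set l \<subseteq> {..n} \<and> length l \<le> n}"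
    using len by (auto simp: partitions_def intro: member_le_sum_list)
  show "finite {l. set l \<subseteq> {..n} \<and> length l \<le> n}"
    by (rule finite_lists_length_le) simp
qed

text \<open>
  A monomial in the variables \<open>x\<^sub>0, x\<^sub>1, \<dots>\<close> is encoded as the multiset of the indices of
  its variables: \<open>count M i\<close> is the exponent of \<open>x\<^sub>i\<close> and \<open>size M\<close> is the degree. A formal
  power series of bounded degree is the function sending a monomial to its coefficient.
  As \<open>\<Lambda>\<^sub>n\<close> is a free module with basis the \<open>m\<^sub>\<lambda>\<close>, the module \<open>R \<otimes> \<Lambda>\<^sub>n\<close> is the set of
  homogeneous symmetric functions of degree \<open>n\<close> with coefficients in \<open>R\<close>.
\<close>

definition symmetric_functions :: "nat \<Rightarrow> (nat multiset \<Rightarrow> 'a::zero) set" where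
  "symmetric_functions n =
     {f. (\<forall>M. size M \<noteq> n \<longrightarrow> f M = 0) \<and>
         (\<forall>\<pi> M. bij \<pi> \<longrightarrow> f (image_mset \<pi> M) = f M)}"

definition monomial_symmetric :: "nat list \<Rightarrow> nat multiset \<Rightarrow> 'a::zero_neq_one" where
  "monomial_symmetric l M =
     (if image_mset (count M) (mset_set (set_mset M)) = mset l then 1 else 0)"


section \<open>The symmetric group as a Coxeter group\<close>

abbreviation sym_group :: "nat \<Rightarrow> (nat \<Rightarrow> nat) set" where
  "sym_group n \<equiv> {w. w permutes {1..n}}"

abbreviation adj_transp :: "nat \<Rightarrow> nat \<Rightarrow> nat" where
  "adj_transp i \<equiv> Transposition.transpose i (Suc i)"

definition word_perm :: "nat list \<Rightarrow> nat \<Rightarrow> nat" where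
  "word_perm is = foldr (\<lambda>i w. adj_transp i \<circ> w) is id"

definition is_expression :: "nat \<Rightarrow> (nat \<Rightarrow> nat) \<Rightarrow> nat list \<Rightarrow> bool" where
  "is_expression n w is \<longleftrightarrow> set is \<subseteq> {1..<n} \<and> word_perm is = w"

definition coxeter_length :: "nat \<Rightarrow> (nat \<Rightarrow> nat) \<Rightarrow> nat" where
  "coxeter_length n w = (LEAST k. \<exists>is. is_expression n w is \<and> length is = k)"

definition reduced_expression :: "nat \<Rightarrow> (nat \<Rightarrow> nat) \<Rightarrow> nat list \<Rightarrow> bool" where
  "reduced_expression n w is \<longleftrightarrow> is_expression n w is \<and> length is = coxeter_length n w"

definition young_block :: "nat list \<Rightarrow> nat \<Rightarrow> nat set" where
  "young_block l j = {sum_list (take j l)<..sum_list (take (Suc j) l)}"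

definition young_subgroup :: "nat \<Rightarrow> nat list \<Rightarrow> (nat \<Rightarrow> nat) set" where
  "young_subgroup n l =
     {w \<in> sym_group n. \<forall>j<length l. w ` young_block l j = young_block l j}"


section \<open>Trace on a quotient space\<close>

definition basis_modulo ::
  "('k::field \<Rightarrow> 'v::ab_group_add \<Rightarrow> 'v) \<Rightarrow> 'v set \<Rightarrow> 'v set \<Rightarrow> bool" where
  "basis_modulo scale W B \<longleftrightarrow> finite B \<and>
     (\<forall>c. (\<Sum>b\<in>B. scale (c b) b) \<in> W \<longrightarrow> (\<forall>b\<in>B. c b = 0)) \<and>
     module.span scale (B \<union> W) = UNIV"

text \<open>
  The trace of the endomorphism of \<open>V/W\<close> induced by an endomorphism \<open>f\<close> of \<open>V\<close> which maps
  the subspace \<open>W\<close> to itself, where \<open>V/W\<close> is finite-dimensional; \<open>c\<close> is the matrix of that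
  endomorphism in the basis of \<open>V/W\<close> represented by \<open>B\<close>.
\<close>

definition quotient_trace ::
  "('k::field \<Rightarrow> 'v::ab_group_add \<Rightarrow> 'v) \<Rightarrow> 'v set \<Rightarrow> ('v \<Rightarrow> 'v) \<Rightarrow> 'k" where
  "quotient_trace scale W f =
     (THE t. \<exists>B c. basis_modulo scale W B \<and>
        (\<forall>b\<in>B. f b - (\<Sum>b'\<in>B. scale (c b' b) b') \<in> W) \<and>
        t = (\<Sum>b\<in>B. c b b))"


section \<open>The Hecke algebra and its induced sign characters\<close>

text \<open>
  The type \<open>'h\<close> is the algebra \<open>\<rat>(q) \<otimes> H\<^sub>n(q)\<close>, and \<open>T w\<close> is \<open>T\<^sub>w\<close> for \<open>w\<close> in \<open>\<SS>\<^sub>n\<close>;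
  values of \<open>T\<close> outside \<open>\<SS>\<^sub>n\<close> are irrelevant. As a \<open>\<rat>(q)\<close>-algebra with the elements \<open>T\<^sub>w\<close>
  it is determined up to unique isomorphism by these assumptions.
\<close>

locale hecke_algebra = vector_space scale
  for scale :: "ratq \<Rightarrow> 'h::ring_1 \<Rightarrow> 'h" +
  fixes n :: nat and T :: "(nat \<Rightarrow> nat) \<Rightarrow> 'h"
  assumes scale_mult_left: "scale c x * y = scale c (x * y)"
    and scale_mult_right: "x * scale c y = scale c (x * y)"
    and quadratic: "i \<in> {1..<n} \<Longrightarrow>
      T (adj_transp i) * T (adj_transp i) = scale (qvar - 1) (T (adj_transp i)) + scale qvar 1"
    and commute: "i \<in> {1..<n} \<Longrightarrow> j \<in> {1..<n} \<Longrightarrow> i + 2 \<le> j \<Longrightarrow>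
      T (adj_transp i) * T (adj_transp j) = T (adj_transp j) * T (adj_transp i)"
    and braid: "i \<in> {1..<n} \<Longrightarrow> Suc i \<in> {1..<n} \<Longrightarrow>
      T (adj_transp i) * T (adj_transp (Suc i)) * T (adj_transp i) =
      T (adj_transp (Suc i)) * T (adj_transp i) * T (adj_transp (Suc i))"
    and T_reduced: "w \<in> sym_group n \<Longrightarrow> reduced_expression n w is \<Longrightarrow>
      T w = prod_list (map (\<lambda>i. T (adj_transp i)) is)"
    and T_inj: "inj_on T (sym_group n)"
    and T_independent: "independent (T ` sym_group n)"
    and T_span: "span (T ` sym_group n) = UNIV"
begin

text \<open>
  The parabolic subalgebra \<open>H\<^sub>\<lambda>(q)\<close> is spanned by the \<open>T\<^sub>u\<close> with \<open>u\<close> in the Young subgroup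
  \<open>\<SS>\<^sub>\<lambda>\<close>. Inducing its sign module gives the left module \<open>H \<otimes> k\<close> (tensor product over
  \<open>H\<^sub>\<lambda>\<close>, with \<open>k = \<rat>(q)\<close>), which is the quotient of \<open>H = H \<otimes>\<^sub>k k\<close> by the relations
  \<open>h b \<otimes> 1 = h \<otimes> b 1\<close> for \<open>b\<close> in \<open>H\<^sub>\<lambda>\<close>; by linearity it suffices to impose these for
  \<open>b = T\<^sub>u\<close>, where \<open>T\<^sub>u\<close> acts on \<open>k\<close> as the sign \<open>(-1)\<^bsup>\<ell>(u)\<^esup>\<close>.
\<close>

definition induced_relations :: "nat list \<Rightarrow> 'h set" where
  "induced_relations l =
     span {h * T u - scale ((-1) ^ coxeter_length n u) h | h u. u \<in> young_subgroup n l}"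

definition induced_sign_character :: "nat list \<Rightarrow> 'h \<Rightarrow> ratq" where
  "induced_sign_character l g = quotient_trace scale (induced_relations l) (\<lambda>x. g * x)"

definition Y :: "'h \<Rightarrow> nat multiset \<Rightarrow> ratq" where
  "Y g = (\<lambda>M. \<Sum>l\<in>partitions n. induced_sign_character l g * monomial_symmetric l M)"

end

end

theory Submission
  imports
    Defs
    "HOL-Computational_Algebra.Field_as_Ring"
begin

text \<open>
  For \<open>y = \<Sum> (-1/q)\<^bsup>\<ell>(u)\<^esup> T\<^sub>u\<close> (sum over the Young subgroup of \<open>\<lambda>\<close>) one has \<open>T\<^sub>u y = (-1)\<^bsup>\<ell>(u)\<^esup> y\<close>, so a
  multiple \<open>e\<close> of \<open>y\<close> is idempotent and the induced module is \<open>H e\<close>. Hence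
  the character at \<open>g\<close> is the trace of \<open>x \<mapsto> g x e\<close> on \<open>H\<close>. For \<open>g = T\<^sub>a\<close> this
  trace is regular at \<open>q = 1\<close>, where it specialises to a signed count of the \<open>w\<close> that conjugate
  \<open>a\<close> into the Young subgroup. Taking for \<open>a\<close> a permutation whose cycles are the blocks of a
  partition \<open>\<mu>\<close>, the count vanishes unless \<open>\<mu>\<close> refines \<open>\<lambda>\<close>, and it is nonzero for
  \<open>\<mu> = \<lambda>\<close>. By this triangularity the characters are linearly independent over the valuation
  ring of \<open>q = 1\<close>, hence over \<open>\<rat>(q)\<close>, so they take arbitrary prescribed values
  simultaneously.
\<close>

section \<open>Rational functions regular at \<open>q = 1\<close>\<close>

text \<open>A relation rather than a function, because a fraction with a pole at 1 has no value
  there. The fraction \<open>p / s\<close> need not be in lowest terms, so the closure properties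
  follow by cross-multiplication.\<close>

definition value_at_one :: "ratq \<Rightarrow> rat \<Rightarrow> bool" where
  "value_at_one x r \<longleftrightarrow>
     (\<exists>p s. poly s 1 \<noteq> 0 \<and> x * to_fract s = to_fract p \<and> poly p 1 = r * poly s 1)"

text \<open>Two representations are cross-multiplied and evaluated at 1, where both denominators are
  nonzero. This turns identities over the field of fractions into identities of rational
  numbers.\<close>

lemma value_at_one_unique:
  assumes "value_at_one x r" "value_at_one x r'"
  shows "r = r'"
proof -
  obtain p s where 1: "poly s 1 \<noteq> 0" "x * to_fract s = to_fract p" "poly p 1 = r * poly s 1"
    using assms(1) unfolding value_at_one_def by blast
  obtain p' s' where 2: "poly s' 1 \<noteq> 0" "x * to_fract s' = to_fract p'" "poly p' 1 = r' * poly s' 1"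
    using assms(2) unfolding value_at_one_def by blast
  have "to_fract (p * s') = to_fract (p' * s)"
    unfolding to_fract_mult 1(2)[symmetric] 2(2)[symmetric] by (simp add: mult_ac)
  then have "p * s' = p' * s"
    unfolding to_fract_eq_iff .
  then have "poly p 1 * poly s' 1 = poly p' 1 * poly s 1"
    by (metis poly_mult)
  then show ?thesis
    using 1 2 by simp
qed

lemma value_at_one_const:
  "value_at_one 0 0" "value_at_one 1 1" "value_at_one (- 1) (- 1)"
proof -
  show "value_at_one 0 0" "value_at_one 1 1"
    unfolding value_at_one_def by (rule exI[of _ 0] exI[of _ 1], rule exI[of _ 1], simp)+
  show "value_at_one (- 1) (- 1)"
    unfolding value_at_one_def by (rule exI[of _ "- 1"], rule exI[of _ 1], simp)
qed

lemma value_at_one_qvar: "value_at_one qvar 1"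
  unfolding value_at_one_def qvar_def by (rule exI[of _ "[:0, 1:]"], rule exI[of _ 1]) simp

lemma value_at_one_add:
  assumes "value_at_one x r" "value_at_one x' r'"
  shows "value_at_one (x + x') (r + r')"
proof -
  obtain p s where 1: "poly s 1 \<noteq> 0" "x * to_fract s = to_fract p" "poly p 1 = r * poly s 1"
    using assms(1) unfolding value_at_one_def by blast
  obtain p' s' where 2: "poly s' 1 \<noteq> 0" "x' * to_fract s' = to_fract p'" "poly p' 1 = r' * poly s' 1"
    using assms(2) unfolding value_at_one_def by blast
  have "(x + x') * to_fract (s * s') = to_fract (p * s' + p' * s)"
    unfolding to_fract_mult to_fract_add 1(2)[symmetric] 2(2)[symmetric] by (simp add: algebra_simps)
  with 1 2 show ?thesis
    unfolding value_at_one_def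
    by (intro exI[of _ "p * s' + p' * s"] exI[of _ "s * s'"]) (simp add: algebra_simps)
qed

lemma value_at_one_mult:
  assumes "value_at_one x r" "value_at_one x' r'"
  shows "value_at_one (x * x') (r * r')"
proof -
  obtain p s where 1: "poly s 1 \<noteq> 0" "x * to_fract s = to_fract p" "poly p 1 = r * poly s 1"
    using assms(1) unfolding value_at_one_def by blast
  obtain p' s' where 2: "poly s' 1 \<noteq> 0" "x' * to_fract s' = to_fract p'" "poly p' 1 = r' * poly s' 1"
    using assms(2) unfolding value_at_one_def by blast
  have "(x * x') * to_fract (s * s') = to_fract (p * p')"
    unfolding to_fract_mult 1(2)[symmetric] 2(2)[symmetric] by (simp add: algebra_simps)
  with 1 2 show ?thesis
    unfolding value_at_one_def
    by (intro exI[of _ "p * p'"] exI[of _ "s * s'"]) (simp add: algebra_simps)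
qed

lemma value_at_one_inverse:
  assumes "value_at_one x r" "r \<noteq> 0"
  shows "value_at_one (inverse x) (inverse r)"
proof -
  obtain p s where 1: "poly s 1 \<noteq> 0" "x * to_fract s = to_fract p" "poly p 1 = r * poly s 1"
    using assms(1) unfolding value_at_one_def by blast
  then have "poly p 1 \<noteq> 0"
    using assms(2) by simp
  then have "p \<noteq> 0"
    by auto
  then have "x \<noteq> 0"
    using 1(2) by auto
  then have "inverse x * to_fract p = to_fract s"
    by (simp flip: 1(2))
  then show ?thesis
    unfolding value_at_one_def using 1 \<open>poly p 1 \<noteq> 0\<close> assms(2)
    by (intro exI[of _ s] exI[of _ p]) simp
qed

lemma value_at_one_diff:
  "value_at_one x r \<Longrightarrow> value_at_one x' r' \<Longrightarrow> value_at_one (x - x') (r - r')"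
  using value_at_one_add[OF _ value_at_one_mult[OF value_at_one_const(3)]] by force

lemma value_at_one_power: "value_at_one x r \<Longrightarrow> value_at_one (x ^ k) (r ^ k)"
  by (induction k) (auto intro: value_at_one_const value_at_one_mult)

lemma value_at_one_sum:
  "(\<And>i. i \<in> A \<Longrightarrow> value_at_one (f i) (r i)) \<Longrightarrow> value_at_one (sum f A) (sum r A)"
  by (induction A rule: infinite_finite_induct) (auto intro: value_at_one_const value_at_one_add)

text \<open>The fractions that are regular at \<open>q = 1\<close> form a valuation ring.\<close>

lemma value_at_one_dichotomy:
  assumes "\<nexists>r. value_at_one x r"
  shows "value_at_one (inverse x) 0"
proof -
  define p s where "p = fst (quot_of_fract x)" and "s = snd (quot_of_fract x)"
  have s: "s \<noteq> 0"
    unfolding s_def by simp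
  have x: "x = to_fract p / to_fract s"
    using Fract_quot_of_fract[of x] unfolding p_def s_def Fract_conv_to_fract by simp
  have "poly s 1 = 0"
  proof (rule ccontr)
    assume "poly s 1 \<noteq> 0"
    then have "value_at_one x (poly p 1 / poly s 1)"
      unfolding value_at_one_def x using s by (intro exI[of _ p] exI[of _ s]) simp
    with assms show False
      by blast
  qed
  moreover have "coprime p s"
    unfolding p_def s_def by (rule coprime_quot_of_fract)
  \<comment> \<open>A polynomial vanishes at 1 exactly when \<open>[:- 1, 1:]\<close> divides it.
    This divisor is not a unit, so the coprime \<open>p\<close> and \<open>s\<close> cannot both
    vanish there.\<close>
  ultimately have "poly p 1 \<noteq> 0"
    using coprime_common_divisor[of p s "[:- 1, 1:]"] by (auto simp: poly_eq_0_iff_dvd is_unit_poly_iff)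
  then show ?thesis
    unfolding value_at_one_def x using \<open>poly s 1 = 0\<close>
    by (intro exI[of _ s] exI[of _ p]) auto
qed

text \<open>Scaling by the coefficient with the worst pole at \<open>q = 1\<close>.\<close>

lemma dominant_coefficient:
  assumes "finite I" "i \<in> I" "a i \<noteq> 0"
  shows "\<exists>k\<in>I. a k \<noteq> 0 \<and> (\<forall>i\<in>I. \<exists>r. value_at_one (a i / a k) r)"
  using assms
proof (induction I arbitrary: i rule: finite_induct)
  case (insert j I)
  show ?case
  proof (cases "\<exists>i\<in>I. a i \<noteq> 0")
    case False
    then have "a j \<noteq> 0"
      using insert.prems by auto
    with False show ?thesis
      using value_at_one_const by fastforce
  next
    case True
    then obtain k where k: "k \<in> I" "a k \<noteq> 0" "\<And>i. i \<in> I \<Longrightarrow> \<exists>r. value_at_one (a i / a k) r"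
      using insert.IH by blast
    show ?thesis
    proof (cases "\<exists>r. value_at_one (a j / a k) r")
      case True
      with k have "\<forall>i\<in>insert j I. \<exists>r. value_at_one (a i / a k) r"
        by blast
      with k show ?thesis
        by blast
    next
      case False
      \<comment> \<open>A pole of \<open>a j / a k\<close> makes the inverse ratio vanish at 1. So
        \<open>j\<close> takes over as pivot, and the old ratios stay regular after multiplication
        by \<open>a k / a j\<close>.\<close>
      then have j: "value_at_one (a k / a j) 0"
        using value_at_one_dichotomy by fastforce
      have "a j \<noteq> 0"
        using False value_at_one_const by force
      moreover have "\<exists>r. value_at_one (a i / a j) r" if "i \<in> insert j I" for i
      proof (cases "i = j")
        case True
        then show ?thesis
          using \<open>a j \<noteq> 0\<close> value_at_one_const by auto
      next
        case False
        with that have "i \<in> I"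
          by simp
        then obtain r where "value_at_one (a i / a k) r"
          using k(3) by blast
        from value_at_one_mult[OF this j] show ?thesis
          using k(2) by auto
      qed
      ultimately show ?thesis
        by blast
    qed
  qed
qed simp

section \<open>Traces and linear functionals\<close>

lemma (in vector_space) sum_representation_eq:
  assumes "finite V" "independent V" "x \<in> span V"
  shows "(\<Sum>v\<in>V. scale (representation V x v) v) = x"
proof -
  have "(\<Sum>v | representation V x v \<noteq> 0. scale (representation V x v) v) = (\<Sum>v\<in>V. scale (representation V x v) v)"
    by (rule sum.mono_neutral_left) (use assms(1) representation_ne_zero in auto)
  then show ?thesis
    using sum_nonzero_representation_eq[OF assms(2,3)] by simp
qed

text \<open>The projection \<open>P\<close> identifies the quotient by its kernel with its range,
  compatibly with \<open>f\<close> because the two commute. Since \<open>f \<circ> P\<close>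
  vanishes on the kernel, the quotient trace is the trace of \<open>f \<circ> P\<close> on the whole
  space, which is read off in the basis \<open>V\<close>.\<close>

lemma quotient_trace_projection:
  fixes scale :: "'k::field \<Rightarrow> 'v::ab_group_add \<Rightarrow> 'v"
  assumes "vector_space scale"
    and V: "finite V" "\<not> module.dependent scale V" "module.span scale V = UNIV"
    and f: "Vector_Spaces.linear scale scale f"
    and P: "Vector_Spaces.linear scale scale P"
    and idem: "\<And>x. P (P x) = P x"
    and comm: "\<And>x. P (f x) = f (P x)"
  shows "quotient_trace scale {x. P x = 0} f = (\<Sum>v\<in>V. module.representation scale V (f (P v)) v)"
proof -
  interpret vector_space scale by fact
  interpret f: Vector_Spaces.linear scale scale f by fact
  interpret P: Vector_Spaces.linear scale scale P by fact
  let ?W = "{x. P x = 0}" and ?t = "\<Sum>v\<in>V. representation V (f (P v)) v"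
  have rep_sum: "representation V (sum h A) v = (\<Sum>a\<in>A. representation V (h a) v)" for h :: "'v \<Rightarrow> 'v" and A v
    by (subst representation_sum[OF V(2)]) (simp_all add: V)
  have rep_scale: "representation V (scale c x) v = c * representation V x v" for c x v
    by (subst representation_scale[OF V(2)]) (simp_all add: V)
  have sub: "subspace ?W"
    by (rule subspaceI) (auto simp: P.add P.scale)
  \<comment> \<open>The definite description in \<open>quotient_trace\<close> requires every
    admissible choice of \<open>B\<close> and \<open>c\<close> to give the same value.\<close>
  have uniq: "t = ?t" if B: "basis_modulo scale ?W B"
    and c: "\<forall>b\<in>B. f b - (\<Sum>b'\<in>B. scale (c b' b) b') \<in> ?W" and t: "t = (\<Sum>b\<in>B. c b b)" for B c t
  proof -
    have fin: "finite B" and ind: "\<And>c b. P (\<Sum>b\<in>B. scale (c b) b) = 0 \<Longrightarrow> b \<in> B \<Longrightarrow> c b = 0"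
      and sp: "span (B \<union> ?W) = UNIV"
      using B unfolding basis_modulo_def by blast+
    have "\<exists>d. P x = (\<Sum>b\<in>B. scale (d b) (P b))" for x
    proof -
      have "x \<in> span (B \<union> ?W)"
        using sp by simp
      then obtain y z where x: "x = y + z" "y \<in> span B" "z \<in> span ?W"
        unfolding span_Un by blast
      obtain d where "y = (\<Sum>b\<in>B. scale (d b) b)"
        using x(2) span_finite[OF fin] by auto
      moreover have "P z = 0"
        using span_minimal[OF order_refl sub] x(3) by blast
      ultimately show ?thesis
        using x(1) by (auto simp: P.add P.sum P.scale)
    qed
    \<comment> \<open>The vectors \<open>P b\<close> span the range of \<open>P\<close>;
      \<open>d x\<close> holds coordinates of \<open>P x\<close> in them.\<close>
    then obtain d where d: "\<And>x. P x = (\<Sum>b\<in>B. scale (d x b) (P b))"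
      by metis
    have fP: "f (P b) = (\<Sum>b'\<in>B. scale (c b' b) (P b'))" if "b \<in> B" for b
    proof -
      have "P (f b - (\<Sum>b'\<in>B. scale (c b' b) b')) = 0"
        using c that by blast
      then show ?thesis
        by (simp add: P.diff P.sum P.scale flip: comm)
    qed
    \<comment> \<open>Expanding \<open>P b'\<close> first in \<open>V\<close> and then each
      \<open>P v\<close> in the vectors \<open>P b\<close> must give back \<open>P b'\<close>.
      Independence of \<open>B\<close> modulo the kernel then makes the product of the two
      coordinate matrices the identity.\<close>
    have delta: "(\<Sum>v\<in>V. representation V (P b') v * d v b) = (if b = b' then 1 else 0)"
      if b: "b \<in> B" "b' \<in> B" for b b'
    proof -
      let ?e = "\<lambda>b. (\<Sum>v\<in>V. representation V (P b') v * d v b) - (if b = b' then 1 else 0)"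
      have "P b' = P (\<Sum>v\<in>V. scale (representation V (P b') v) v)"
        using sum_representation_eq[OF V(1,2)] V(3) idem by simp
      also have "\<dots> = (\<Sum>v\<in>V. scale (representation V (P b') v) (\<Sum>b\<in>B. scale (d v b) (P b)))"
        by (simp add: P.sum P.scale flip: d)
      also have "\<dots> = (\<Sum>v\<in>V. \<Sum>b\<in>B. scale (representation V (P b') v * d v b) (P b))"
        by (simp add: scale_sum_right)
      also have "\<dots> = (\<Sum>b\<in>B. scale (\<Sum>v\<in>V. representation V (P b') v * d v b) (P b))"
        by (subst sum.swap) (simp add: scale_sum_left)
      finally have e1: "P b' = (\<Sum>b\<in>B. scale (\<Sum>v\<in>V. representation V (P b') v * d v b) (P b))" .
      have e2: "P b' = (\<Sum>b\<in>B. scale (if b = b' then 1 else 0) (P b))"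
        using fin b by (simp add: if_distrib[of "\<lambda>c. scale c _"] sum.delta cong: if_cong)
      have "P (\<Sum>b\<in>B. scale (?e b) b)
          = (\<Sum>b\<in>B. scale (\<Sum>v\<in>V. representation V (P b') v * d v b) (P b))
            - (\<Sum>b\<in>B. scale (if b = b' then 1 else 0) (P b))"
        by (simp only: P.sum P.scale P.diff scale_left_diff_distrib sum_subtractf)
      also have "\<dots> = 0"
        by (simp only: e1[symmetric] e2[symmetric] diff_self)
      finally have "P (\<Sum>b\<in>B. scale (?e b) b) = 0" .
      from ind[OF this b(1)] show ?thesis
        by simp
    qed
    have "?t = (\<Sum>v\<in>V. \<Sum>b\<in>B. d v b * representation V (f (P b)) v)"
      by (subst d) (simp add: f.sum f.scale rep_sum rep_scale)
    also have "\<dots> = (\<Sum>v\<in>V. \<Sum>b\<in>B. d v b * (\<Sum>b'\<in>B. c b' b * representation V (P b') v))"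
      by (simp add: fP rep_sum rep_scale)
    also have "\<dots> = (\<Sum>v\<in>V. \<Sum>b\<in>B. \<Sum>b'\<in>B. c b' b * (representation V (P b') v * d v b))"
      by (simp add: sum_distrib_left mult_ac)
    also have "\<dots> = (\<Sum>b\<in>B. \<Sum>v\<in>V. \<Sum>b'\<in>B. c b' b * (representation V (P b') v * d v b))"
      by (rule sum.swap)
    also have "\<dots> = (\<Sum>b\<in>B. \<Sum>b'\<in>B. \<Sum>v\<in>V. c b' b * (representation V (P b') v * d v b))"
      by (rule sum.cong[OF refl], rule sum.swap)
    also have "\<dots> = (\<Sum>b\<in>B. \<Sum>b'\<in>B. c b' b * (if b = b' then 1 else 0))"
      by (simp add: delta flip: sum_distrib_left)
    also have "\<dots> = t"
      using fin t by (simp add: if_distrib sum.delta cong: if_cong)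
    finally show ?thesis
      by simp
  qed
  have ex: "\<exists>B c. basis_modulo scale ?W B \<and> (\<forall>b\<in>B. f b - (\<Sum>b'\<in>B. scale (c b' b) b') \<in> ?W)"
  proof -
    \<comment> \<open>A basis of the range of \<open>P\<close> represents a basis of the quotient:
      \<open>P\<close> fixes its elements, and \<open>x - P x\<close> always lies in the
      kernel.\<close>
    obtain B where B: "B \<subseteq> range P" "independent B" "range P \<subseteq> span B"
      using maximal_independent_subset by blast
    have fin: "finite B"
      using independent_span_bound[OF V(1) B(2)] V(3) by auto
    have PB: "P b = b" if "b \<in> B" for b
      using B(1) that idem by auto
    have comb: "\<exists>d. P x = (\<Sum>b\<in>B. scale (d b) b)" for x
    proof -
      have "P x \<in> span B"
        using B(3) by auto
      then show ?thesis
        using span_finite[OF fin] by auto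
    qed
    have "basis_modulo scale ?W B"
      unfolding basis_modulo_def
    proof (intro conjI allI impI ballI)
      fix c b
      assume "(\<Sum>b\<in>B. scale (c b) b) \<in> ?W" and b: "b \<in> B"
      then have "(\<Sum>b\<in>B. scale (c b) b) = 0"
        by (simp add: P.sum P.scale PB)
      then show "c b = 0"
        using independentD[OF B(2) fin _ _ b] by blast
    next
      have "x \<in> span (B \<union> ?W)" for x
      proof -
        have "P x \<in> span (B \<union> ?W)"
          using B(3) span_mono[of B "B \<union> ?W"] by blast
        moreover have "x - P x \<in> span (B \<union> ?W)"
          by (rule span_base) (simp add: P.diff idem)
        ultimately show ?thesis
          using span_add by fastforce
      qed
      then show "span (B \<union> ?W) = UNIV"
        by auto
    qed (fact fin)
    moreover obtain c where "\<And>x. P (f x) = (\<Sum>b'\<in>B. scale (c b' x) b')"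
    proof -
      obtain e where "\<And>x. P x = (\<Sum>b\<in>B. scale (e x b) b)"
        using comb by metis
      then show ?thesis
        using that[of "\<lambda>b x. e (f x) b"] by blast
    qed
    then have "f b - (\<Sum>b'\<in>B. scale (c b' b) b') \<in> ?W" for b
      by (metis (mono_tags, lifting) P.diff idem mem_Collect_eq right_minus_eq)
    ultimately show ?thesis
      by blast
  qed
  obtain B c where Bc: "basis_modulo scale ?W B" "\<forall>b\<in>B. f b - (\<Sum>b'\<in>B. scale (c b' b) b') \<in> ?W"
    using ex by blast
  show ?thesis
    unfolding quotient_trace_def
  proof (rule the_equality)
    show "\<exists>B c. basis_modulo scale ?W B
        \<and> (\<forall>b\<in>B. f b - (\<Sum>b'\<in>B. scale (c b' b) b') \<in> ?W) \<and> ?t = (\<Sum>b\<in>B. c b b)"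
      using Bc uniq[OF Bc refl] by (intro exI[of _ B] exI[of _ c] conjI) (auto simp only:)
  next
    fix t
    assume "\<exists>B c. basis_modulo scale ?W B
        \<and> (\<forall>b\<in>B. f b - (\<Sum>b'\<in>B. scale (c b' b) b') \<in> ?W) \<and> t = (\<Sum>b\<in>B. c b b)"
    then show "t = ?t"
      by (elim exE conjE) (rule uniq)
  qed
qed

text \<open>Induction on the set of functionals. Once those in \<open>I\<close> have their
  prescribed values, the value of the new one is corrected along a vector on which all of
  \<open>I\<close> vanishes.\<close>

lemma independent_functionals_surjective:
  fixes scale :: "'k::field \<Rightarrow> 'v::ab_group_add \<Rightarrow> 'v"
  assumes "vector_space scale" "finite I"
    and "\<And>i. i \<in> I \<Longrightarrow> Vector_Spaces.linear scale (*) (\<chi> i)"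
    and "\<And>a i. (\<And>x. (\<Sum>i\<in>I. a i * \<chi> i x) = 0) \<Longrightarrow> i \<in> I \<Longrightarrow> a i = 0"
  shows "\<exists>x. \<forall>i\<in>I. \<chi> i x = b i"
  using assms(2-4)
proof (induction I arbitrary: b rule: finite_induct)
  case (insert j I)
  interpret vector_space scale by fact
  have lin: "\<chi> i (x + y) = \<chi> i x + \<chi> i y" "\<chi> i (scale c x) = c * \<chi> i x"
    "\<chi> i (x - y) = \<chi> i x - \<chi> i y" "\<chi> i (sum h A) = (\<Sum>a\<in>A. \<chi> i (h a))"
    if "i \<in> insert j I" for i x y c A and h :: "'a \<Rightarrow> 'v"
  proof -
    interpret Vector_Spaces.linear scale "(*)" "\<chi> i"
      using insert.prems(1) that by blast
    show "\<chi> i (x + y) = \<chi> i x + \<chi> i y" "\<chi> i (scale c x) = c * \<chi> i x"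
      "\<chi> i (x - y) = \<chi> i x - \<chi> i y" "\<chi> i (sum h A) = (\<Sum>a\<in>A. \<chi> i (h a))"
      by (rule add scale diff sum)+
  qed
  have surj: "\<exists>x. \<forall>i\<in>I. \<chi> i x = b i" for b
  proof (rule insert.IH)
    fix a i
    assume a: "\<And>x. (\<Sum>i\<in>I. a i * \<chi> i x) = 0" and i: "i \<in> I"
    have "(\<Sum>i\<in>insert j I. (if i = j then 0 else a i) * \<chi> i x) = (\<Sum>i\<in>I. a i * \<chi> i x)" for x
      using insert.hyps by (auto intro: sum.cong)
    then show "a i = 0"
      using insert.prems(2)[of "\<lambda>i. if i = j then 0 else a i" i] a i insert.hyps by (auto split: if_splits)
  qed (use insert.prems in blast)
  have "\<exists>x. \<forall>i\<in>I. \<chi> i x = (if i = k then 1 else 0)" for k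
    by (rule surj)
  then obtain g where g: "\<And>i k. i \<in> I \<Longrightarrow> \<chi> i (g k) = (if i = k then 1 else 0)"
    by metis
  obtain x0 where x0: "\<And>i. i \<in> I \<Longrightarrow> \<chi> i x0 = b i"
    using surj by blast
  \<comment> \<open>These are the coefficients of \<open>\<chi> j\<close> minus its interpolation
    through the dual vectors \<open>g\<close>. The coefficient 1 at \<open>j\<close> makes the
    combination nontrivial, so it is nonzero at some \<open>h\<close>.\<close>
  let ?a = "\<lambda>i. if i = j then 1 else - \<chi> j (g i)"
  have "\<exists>h. (\<Sum>i\<in>insert j I. ?a i * \<chi> i h) \<noteq> 0"
    using insert.prems(2)[of ?a j] by auto
  then obtain h where "(\<Sum>i\<in>insert j I. ?a i * \<chi> i h) \<noteq> 0"
    by blast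
  moreover have "(\<Sum>i\<in>insert j I. ?a i * \<chi> i h) = \<chi> j h + (\<Sum>i\<in>I. - \<chi> j (g i) * \<chi> i h)"
    using insert.hyps by (auto intro: sum.cong)
  ultimately have h: "\<chi> j h - (\<Sum>i\<in>I. \<chi> i h * \<chi> j (g i)) \<noteq> 0"
    by (simp add: sum_negf mult.commute)
  \<comment> \<open>Removing the components along the \<open>g i\<close> puts \<open>h'\<close> in
    the common kernel of \<open>I\<close>, and \<open>\<chi> j h'\<close> is exactly the nonzero
    value just found.\<close>
  define h' where "h' = h - (\<Sum>i\<in>I. scale (\<chi> i h) (g i))"
  have h'_I: "\<chi> i h' = 0" if "i \<in> I" for i
    using that insert.hyps by (simp add: h'_def lin g if_distrib[of "(*) _"] cong: if_cong)
  have h'_j: "\<chi> j h' \<noteq> 0"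
    using h by (simp add: h'_def lin)
  have "\<chi> i (x0 + scale ((b j - \<chi> j x0) / \<chi> j h') h') = b i" if "i \<in> insert j I" for i
    using that h'_I h'_j x0 by (cases "i = j") (auto simp: lin)
  then show ?case
    by blast
qed simp

section \<open>Monomial expansion of symmetric functions\<close>

text \<open>Induction on \<open>A\<close>: an element is matched with one of the same label in
  \<open>A'\<close>, and both are removed.\<close>

lemma bij_betw_of_image_mset_eq:
  assumes "finite A" "finite A'" "image_mset c (mset_set A) = image_mset c' (mset_set A')"
  shows "\<exists>g. bij_betw g A A' \<and> (\<forall>a\<in>A. c' (g a) = c a)"
  using assms
proof (induction A arbitrary: A' rule: finite_induct)
  case empty
  then show ?case
    by (auto simp: bij_betw_def mset_set_empty_iff)
next
  case (insert a A)
  then have "c a \<in># image_mset c' (mset_set A')"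
    by (metis finite.insertI finite_set_mset_mset_set image_eqI insertI1 set_image_mset)
  then obtain a' where a': "a' \<in> A'" "c' a' = c a"
    using insert.prems(1) by auto
  define A'' where "A'' = A' - {a'}"
  have A': "A' = insert a' A''" "a' \<notin> A''" "finite A''"
    using a' insert.prems(1) by (auto simp: A''_def)
  have "image_mset c (mset_set A) = image_mset c' (mset_set A'')"
    using insert.prems(2) insert.hyps A' a' by simp
  then obtain g where g: "bij_betw g A A''" "\<forall>a\<in>A. c' (g a) = c a"
    using insert.IH A'(3) by blast
  have "bij_betw (g(a := a')) A A''"
    using g(1) insert.hyps(2) by (subst bij_betw_cong[of _ _ g]) auto
  then have "bij_betw (g(a := a')) (insert a A) A'"
    using notIn_Un_bij_betw[of a A "g(a := a')" A''] insert.hyps(2) A' by simp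
  moreover have "\<forall>x\<in>insert a A. c' ((g(a := a')) x) = c x"
    using g(2) a'(2) by simp
  ultimately show ?case
    by blast
qed

text \<open>Symmetry is stated for bijections of all variables. The supports are matched so that
  exponents agree; the complements, being infinite sets of naturals, are matched by
  enumeration.\<close>

lemma symmetric_functions_eq:
  assumes "F \<in> symmetric_functions n"
    and "image_mset (count M) (mset_set (set_mset M)) = image_mset (count M') (mset_set (set_mset M'))"
  shows "F M = F M'"
proof -
  obtain g where g: "bij_betw g (set_mset M) (set_mset M')" "\<And>x. x \<in># M \<Longrightarrow> count M' (g x) = count M x"
    using bij_betw_of_image_mset_eq[OF _ _ assms(2)] by auto
  have "infinite (- set_mset M)" "infinite (- set_mset M')"
    by (simp_all add: finite_compl)
  then have "bij_betw (enumerate (- set_mset M') \<circ> inv_into UNIV (enumerate (- set_mset M)))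
      (- set_mset M) (- set_mset M')"
    by (intro bij_betw_trans[OF bij_betw_inv_into[OF bij_enumerate] bij_enumerate])
  then obtain h where h: "bij_betw h (- set_mset M) (- set_mset M')"
    by blast
  define p where "p x = (if x \<in># M then g x else h x)" for x
  have p1: "bij_betw p (set_mset M) (set_mset M')"
    using g(1) by (subst bij_betw_cong[of _ _ g]) (auto simp: p_def)
  moreover have p2: "bij_betw p (- set_mset M) (- set_mset M')"
    using h by (subst bij_betw_cong[of _ _ h]) (auto simp: p_def)
  ultimately have "bij_betw p (set_mset M \<union> - set_mset M) (set_mset M' \<union> - set_mset M')"
    by (rule bij_betw_combine) auto
  then have p: "bij p"
    by simp
  have "image_mset p M = M'"
  proof (rule multiset_eqI)
    fix y
    obtain x where y: "y = p x"
      using p by (metis bij_pointE)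
    have "count (image_mset p M) (p x) = count M x"
      using p by (induction M) (auto dest: bij_is_inj simp: inj_eq)
    also have "count M x = count M' (p x)"
    proof (cases "x \<in># M")
      case True
      then show ?thesis
        using g(2) by (simp add: p_def)
    next
      case False
      moreover from False have "p x \<notin># M'"
        using p2 by (metis ComplD ComplI bij_betwE)
      ultimately show ?thesis
        by (simp add: not_in_iff)
    qed
    finally show "count (image_mset p M) y = count M' y"
      by (simp add: y)
  qed
  with assms(1) p show ?thesis
    unfolding symmetric_functions_def by fastforce
qed

lemma partitions_mset_eq:
  assumes "l \<in> partitions n" "l' \<in> partitions n'" "mset l = mset l'"
  shows "l = l'"
proof -
  have "sorted (rev l)" "sorted (rev l')"
    using assms(1,2) by (auto simp: partitions_def sorted_wrt_rev)
  then have "rev l = rev l'"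
    using assms(3) by (metis mset_rev properties_for_sort)
  then show ?thesis
    by simp
qed

lemma sum_count_eq_size: "sum_mset (image_mset (count M) (mset_set (set_mset M))) = size M"
  by (simp add: size_multiset_overloaded_eq sum_unfold_sum_mset)

lemma partition_of_monomial:
  "\<exists>l\<in>partitions (size M). mset l = image_mset (count M) (mset_set (set_mset M))"
proof -
  let ?c = "image_mset (count M) (mset_set (set_mset M))"
  define l where "l = rev (sorted_list_of_multiset ?c)"
  have mset: "mset l = ?c"
    by (simp add: l_def)
  then have "set l = count M ` set_mset M"
    by (metis finite_set_mset finite_set_mset_mset_set set_image_mset set_mset_mset)
  then have "0 \<notin> set l"
    by (metis count_greater_zero_iff imageE less_irrefl)
  moreover have "sum_list l = size M"
    using mset sum_count_eq_size by (metis sum_mset_sum_list)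
  moreover have "sorted_wrt (\<ge>) l"
    by (simp add: l_def sorted_wrt_rev)
  ultimately show ?thesis
    using mset by (auto simp: partitions_def)
qed

lemma symmetric_functions_expansion:
  fixes F :: "nat multiset \<Rightarrow> 'a::semiring_1"
  assumes "F \<in> symmetric_functions n"
  shows "\<exists>b. F = (\<lambda>M. \<Sum>l\<in>partitions n. b l * monomial_symmetric l M)"
proof -
  let ?c = "\<lambda>M :: nat multiset. image_mset (count M) (mset_set (set_mset M))"
  \<comment> \<open>The coefficient of the monomial function of a partition is the value of
    \<open>F\<close> at any monomial with these exponents; by symmetry the choice does not
    matter.\<close>
  define b where "b l = F (SOME M. ?c M = mset l)" for l
  have "F M = (\<Sum>l\<in>partitions n. b l * monomial_symmetric l M)" for M
  proof (cases "size M = n")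
    case True
    then obtain k where k: "k \<in> partitions n" "mset k = ?c M"
      using partition_of_monomial by blast
    have some: "?c (SOME M. ?c M = mset k) = mset k"
      by (rule someI[of "\<lambda>M. ?c M = mset k" M]) (rule k(2)[symmetric])
    have bk: "b k = F M"
      unfolding b_def by (rule symmetric_functions_eq[OF assms trans[OF some k(2)]])
    have "(\<Sum>l\<in>partitions n. b l * monomial_symmetric l M) = (\<Sum>l\<in>partitions n. if l = k then b l else 0)"
    proof (rule sum.cong[OF refl])
      fix l
      assume "l \<in> partitions n"
      then have "?c M = mset l \<longleftrightarrow> l = k"
        using partitions_mset_eq[OF _ k(1)] k(2) by metis
      then show "b l * monomial_symmetric l M = (if l = k then b l else 0)"
        by (simp add: monomial_symmetric_def)
    qed
    with k(1) bk show ?thesis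
      by (simp add: finite_partitions)
  next
    case False
    have "monomial_symmetric l M = (0 :: 'a)" if "l \<in> partitions n" for l
      using that False sum_count_eq_size[of M]
      by (auto simp: monomial_symmetric_def partitions_def sum_mset_sum_list)
    with False show ?thesis
      using assms by (simp add: symmetric_functions_def)
  qed
  then show ?thesis
    by blast
qed

section \<open>Coxeter length and inversions\<close>

lemma adj_transp_permutes: "i \<in> {1..<n} \<Longrightarrow> adj_transp i permutes {1..n}"
  by (rule permutes_swap_id) auto

lemma adj_transp_comp_sym_group: "i \<in> {1..<n} \<Longrightarrow> w \<in> sym_group n \<Longrightarrow> adj_transp i \<circ> w \<in> sym_group n"
  using permutes_compose[OF _ adj_transp_permutes] by blast

lemma adj_transp_comp_cancel: "adj_transp i \<circ> (adj_transp i \<circ> w) = w"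
  by (simp add: fun_eq_iff)

lemma word_perm_simps: "word_perm [] = id" "word_perm (i # is) = adj_transp i \<circ> word_perm is"
  by (simp_all add: word_perm_def)

lemma word_perm_sym_group: "set is \<subseteq> {1..<n} \<Longrightarrow> word_perm is \<in> sym_group n"
proof (induction "is")
  case Nil
  show ?case
    unfolding word_perm_simps using permutes_id by blast
next
  case (Cons i "is")
  then show ?case
    unfolding word_perm_simps by (intro adj_transp_comp_sym_group) auto
qed

text \<open>Inversions are recorded by positions. Left multiplication by \<open>adj_transp i\<close>
  exchanges the values \<open>i\<close> and \<open>Suc i\<close>, so it changes the set by a single
  pair.\<close>

definition inversion_set :: "nat \<Rightarrow> (nat \<Rightarrow> nat) \<Rightarrow> (nat \<times> nat) set" where
  "inversion_set n w = {(a, b). a \<in> {1..n} \<and> b \<in> {1..n} \<and> a < b \<and> w b < w a}"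

lemma finite_inversion_set: "finite (inversion_set n w)"
  by (rule finite_subset[of _ "{1..n} \<times> {1..n}"]) (auto simp: inversion_set_def)

text \<open>No integer lies strictly between \<open>i\<close> and \<open>Suc i\<close>, so
  exchanging them affects only their own comparison.\<close>

lemma adj_transp_less_iff:
  assumes "{x, y} \<noteq> {i, Suc i}"
  shows "adj_transp i x < adj_transp i y \<longleftrightarrow> x < y"
  using assms by (auto simp: transpose_def doubleton_eq_iff)

lemma inversion_set_adj_transp:
  assumes w: "w \<in> sym_group n" and i: "i \<in> {1..<n}" and less: "inv w i < inv w (Suc i)"
  shows "inversion_set n (adj_transp i \<circ> w) = insert (inv w i, inv w (Suc i)) (inversion_set n w)"
    and "(inv w i, inv w (Suc i)) \<notin> inversion_set n w"
proof -
  have perm: "w permutes {1..n}"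
    using w by simp
  have w_inv: "w (inv w x) = x" for x
    using perm by (rule permutes_inverses)
  have eq: "a = inv w x \<longleftrightarrow> w a = x" for a x
    using perm by (metis permutes_inverses)
  have mem: "inv w i \<in> {1..n}" "inv w (Suc i) \<in> {1..n}"
    using i permutes_in_image[OF permutes_inv[OF perm]] by auto
  show "(inv w i, inv w (Suc i)) \<notin> inversion_set n w"
    by (simp add: inversion_set_def w_inv)
  show "inversion_set n (adj_transp i \<circ> w) = insert (inv w i, inv w (Suc i)) (inversion_set n w)"
  proof (intro set_eqI iffI; clarify)
    fix a b
    assume ab: "(a, b) \<in> inversion_set n (adj_transp i \<circ> w)" and nin: "(a, b) \<notin> inversion_set n w"
    then have "{w b, w a} = {i, Suc i}"
      using adj_transp_less_iff[of "w b" "w a" i] unfolding inversion_set_def by auto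
    then consider "w a = i" "w b = Suc i" | "w a = Suc i" "w b = i"
      by (auto simp: doubleton_eq_iff)
    then show "a = inv w i \<and> b = inv w (Suc i)"
    proof cases
      case 1
      then show ?thesis
        by (simp add: eq)
    next
      case 2
      then have "b < a"
        using less by (simp flip: eq)
      with ab show ?thesis
        by (simp add: inversion_set_def)
    qed
  next
    fix a b
    assume ab: "(a, b) \<in> insert (inv w i, inv w (Suc i)) (inversion_set n w)"
    show "(a, b) \<in> inversion_set n (adj_transp i \<circ> w)"
    proof (cases "a = inv w i \<and> b = inv w (Suc i)")
      case True
      then show ?thesis
        using mem less by (auto simp: inversion_set_def w_inv)
    next
      case False
      with ab have *: "(a, b) \<in> inversion_set n w"
        by auto
      have "{w b, w a} \<noteq> {i, Suc i}"
      proof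
        assume "{w b, w a} = {i, Suc i}"
        then have "w a = i \<and> w b = Suc i \<or> w a = Suc i \<and> w b = i"
          by (auto simp: doubleton_eq_iff)
        with * False show False
          using less unfolding inversion_set_def by (auto simp: eq simp flip: eq)
      qed
      with * show ?thesis
        using adj_transp_less_iff[of "w b" "w a" i] by (auto simp: inversion_set_def)
    qed
  qed
qed

lemma card_inversion_set_adj_transp:
  assumes w: "w \<in> sym_group n" and i: "i \<in> {1..<n}"
  shows "inv w i < inv w (Suc i) \<Longrightarrow>
      card (inversion_set n (adj_transp i \<circ> w)) = Suc (card (inversion_set n w))"
    and "inv w (Suc i) < inv w i \<Longrightarrow>
      card (inversion_set n w) = Suc (card (inversion_set n (adj_transp i \<circ> w)))"
proof -
  have up: "card (inversion_set n (adj_transp i \<circ> v)) = Suc (card (inversion_set n v))"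
    if "v \<in> sym_group n" "inv v i < inv v (Suc i)" for v
    using inversion_set_adj_transp[OF that(1) i that(2)] by (simp add: finite_inversion_set)
  show "inv w i < inv w (Suc i) \<Longrightarrow>
      card (inversion_set n (adj_transp i \<circ> w)) = Suc (card (inversion_set n w))"
    using up w by blast
  \<comment> \<open>The descending case is the ascending case for
    \<open>adj_transp i \<circ> w\<close>, as the transposition is an involution.\<close>
  assume less: "inv w (Suc i) < inv w i"
  have "bij w"
    using w permutes_bij by auto
  then have "inv (adj_transp i \<circ> w) = inv w \<circ> adj_transp i"
    by (subst o_inv_distrib) auto
  with less have "inv (adj_transp i \<circ> w) i < inv (adj_transp i \<circ> w) (Suc i)"
    by simp
  from up[OF adj_transp_comp_sym_group[OF i w] this]
  show "card (inversion_set n w) = Suc (card (inversion_set n (adj_transp i \<circ> w)))"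
    by (simp only: adj_transp_comp_cancel)
qed

text \<open>Without a descent \<open>inv w\<close> increases on \<open>{1..n}\<close>, hence
  satisfies \<open>k \<le> inv w k\<close> there, and a permutation with this property is the
  identity.\<close>

lemma left_descent_exists:
  assumes "w \<in> sym_group n" "w \<noteq> id"
  shows "\<exists>i\<in>{1..<n}. inv w (Suc i) < inv w i"
proof (rule ccontr)
  assume neg: "\<not> ?thesis"
  have w: "w permutes {1..n}"
    using assms by simp
  note w' = permutes_inv[OF w]
  have step: "inv w i < inv w (Suc i)" if "i \<in> {1..<n}" for i
    using neg that inj_eq[OF permutes_inj[OF w'], of i "Suc i"] by (metis linorder_neqE_nat n_not_Suc_n)
  have "k \<le> inv w k" if "k \<in> {1..n}" for k
    using that
  proof (induction k)
    case (Suc k)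
    show ?case
    proof (cases "k = 0")
      case True
      then show ?thesis
        using Suc.prems permutes_in_image[OF w', of "Suc k"] by auto
    next
      case False
      then have "k \<le> inv w k" "inv w k < inv w (Suc k)"
        using Suc step by auto
      then show ?thesis
        by simp
    qed
  qed simp
  then have "inv w = id"
    using permutes_natset_ge[OF w'] by simp
  then show False
    using assms(2) permutes_inv_inv[OF w] by simp
qed

text \<open>Bubble sort: cancelling a left descent lowers the number of inversions by one, until the
  identity is reached.\<close>

lemma expression_of_inversions:
  "w \<in> sym_group n \<Longrightarrow> \<exists>is. is_expression n w is \<and> length is = card (inversion_set n w)"
proof (induction "card (inversion_set n w)" arbitrary: w rule: less_induct)
  case less
  show ?case
  proof (cases "w = id")
    case True
    then have "inversion_set n w = {}"
      by (auto simp: inversion_set_def)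
    with True show ?thesis
      by (intro exI[of _ "[]"]) (simp add: is_expression_def word_perm_simps)
  next
    case False
    then obtain i where i: "i \<in> {1..<n}" "inv w (Suc i) < inv w i"
      using left_descent_exists less.prems by blast
    note card = card_inversion_set_adj_transp(2)[OF less.prems i]
    obtain js where "is_expression n (adj_transp i \<circ> w) js"
      "length js = card (inversion_set n (adj_transp i \<circ> w))"
      using less.hyps[of "adj_transp i \<circ> w"] card adj_transp_comp_sym_group[OF i(1) less.prems] by auto
    with card i(1) show ?thesis
      by (intro exI[of _ "i # js"])
        (auto simp: is_expression_def word_perm_simps adj_transp_comp_cancel simp del: comp_apply)
  qed
qed

text \<open>Each letter changes the number of inversions by exactly one, up or down. With the
  expressions built above, this identifies the Coxeter length with the number of inversions.\<close>

lemma inversions_le_expression: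
  assumes "is_expression n w is"
  shows "card (inversion_set n w) \<le> length is"
proof -
  have "set is \<subseteq> {1..<n} \<Longrightarrow> card (inversion_set n (word_perm is)) \<le> length is"
  proof (induction "is")
    case Nil
    have "inversion_set n id = {}"
      by (auto simp: inversion_set_def)
    then show ?case
      by (simp only: word_perm_simps card.empty le0)
  next
    case (Cons i "is")
    then have w: "word_perm is \<in> sym_group n" and i: "i \<in> {1..<n}"
      using word_perm_sym_group by auto
    have "inv (word_perm is) i \<noteq> inv (word_perm is) (Suc i)"
      using w by (metis mem_Collect_eq n_not_Suc_n permutes_inverses(1))
    then show ?case
      unfolding word_perm_simps using card_inversion_set_adj_transp[OF w i] Cons.IH Cons.prems
      by (cases rule: linorder_cases[of "inv (word_perm is) i" "inv (word_perm is) (Suc i)"])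
        (simp_all del: comp_apply)
  qed
  with assms show ?thesis
    by (auto simp: is_expression_def)
qed

lemma coxeter_length_eq_inversions:
  "w \<in> sym_group n \<Longrightarrow> coxeter_length n w = card (inversion_set n w)"
  unfolding coxeter_length_def
  by (rule Least_equality) (use expression_of_inversions inversions_le_expression in blast)+

lemma coxeter_length_id: "coxeter_length n id = 0"
  unfolding coxeter_length_def by (rule Least_eq_0) (auto simp: is_expression_def word_perm_simps)

lemma reduced_expression_exists: "w \<in> sym_group n \<Longrightarrow> \<exists>is. reduced_expression n w is"
  using expression_of_inversions by (fastforce simp: reduced_expression_def coxeter_length_eq_inversions)

lemma coxeter_length_adj_transp:
  assumes "w \<in> sym_group n" "i \<in> {1..<n}"
  shows "inv w i < inv w (Suc i) \<Longrightarrow>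
      coxeter_length n (adj_transp i \<circ> w) = Suc (coxeter_length n w)"
    and "inv w (Suc i) < inv w i \<Longrightarrow>
      coxeter_length n w = Suc (coxeter_length n (adj_transp i \<circ> w))"
  using card_inversion_set_adj_transp[OF assms] assms adj_transp_comp_sym_group[OF assms(2,1)]
  by (simp_all only: coxeter_length_eq_inversions)

lemma coxeter_length_adj_transp_cases:
  assumes "w \<in> sym_group n" "i \<in> {1..<n}"
  obtains (up) "coxeter_length n (adj_transp i \<circ> w) = Suc (coxeter_length n w)"
    | (down) "coxeter_length n w = Suc (coxeter_length n (adj_transp i \<circ> w))"
proof -
  have "inv w i \<noteq> inv w (Suc i)"
    using assms by (metis mem_Collect_eq n_not_Suc_n permutes_inverses(1))
  then show ?thesis
    using coxeter_length_adj_transp[OF assms] that by (meson linorder_neqE_nat)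
qed

lemma reduced_expression_Cons:
  assumes "i \<in> {1..<n}" "reduced_expression n w is"
    and "coxeter_length n (adj_transp i \<circ> w) = Suc (coxeter_length n w)"
  shows "reduced_expression n (adj_transp i \<circ> w) (i # is)"
  using assms by (auto simp: reduced_expression_def is_expression_def word_perm_simps)

lemma sign_coxeter_length:
  assumes "w \<in> sym_group n"
  shows "(-1) ^ coxeter_length n w = sign w"
proof -
  have *: "set is \<subseteq> {1..<n} \<Longrightarrow> sign (word_perm is) = (-1) ^ length is" for "is"
  proof (induction "is")
    case (Cons i "is")
    have "permutation (word_perm is)"
      using word_perm_sym_group[of "is" n] Cons.prems permutes_imp_permutation by force
    then have "sign (adj_transp i \<circ> word_perm is) = - sign (word_perm is)"
      using sign_compose[OF permutation_swap_id, of "word_perm is" i "Suc i"] by (simp add: sign_swap_id)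
    then have "sign (word_perm (i # is)) = - sign (word_perm is)"
      by (simp only: word_perm_simps)
    also have "\<dots> = (-1) ^ length (i # is)"
      using Cons by simp
    finally show ?case .
  qed (unfold word_perm_simps, simp)
  obtain "is" where "reduced_expression n w is"
    using reduced_expression_exists assms by blast
  then show ?thesis
    using * by (auto simp: reduced_expression_def is_expression_def)
qed

section \<open>Young subgroups\<close>

lemma sum_list_take_mono:
  fixes l :: "nat list"
  assumes "j \<le> k"
  shows "sum_list (take j l) \<le> sum_list (take k l)"
proof -
  have "take k l = take j l @ take (k - j) (drop j l)"
    using assms by (metis le_add_diff_inverse take_add)
  then show ?thesis
    by simp
qed

lemma young_block_less:
  assumes "j < k" "x \<in> young_block l j" "y \<in> young_block l k"
  shows "x < y"
  using assms sum_list_take_mono[of "Suc j" k l] by (simp add: young_block_def)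

lemma young_block_unique: "x \<in> young_block l j \<Longrightarrow> x \<in> young_block l k \<Longrightarrow> j = k"
  using young_block_less by (metis less_irrefl linorder_neqE_nat)

lemma young_block_subset: "young_block l j \<subseteq> {1..sum_list l}"
proof -
  have "sum_list (take (Suc j) l) \<le> sum_list l"
    using sum_list_take_mono[of "Suc j" "max (Suc j) (length l)" l] by simp
  then show ?thesis
    by (auto simp: young_block_def)
qed

lemma young_block_cover:
  assumes "x \<in> {1..sum_list l}"
  obtains j where "j < length l" "x \<in> young_block l j"
proof -
  \<comment> \<open>The first partial sum that reaches \<open>x\<close>. The block index is one
    less, because blocks exclude their left end point; \<open>k\<close> is positive because
    \<open>x\<close> is.\<close>
  define k where "k = (LEAST k. x \<le> sum_list (take k l))"
  have le: "x \<le> sum_list (take (length l) l)"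
    using assms by simp
  have k: "x \<le> sum_list (take k l)"
    unfolding k_def by (rule LeastI[where P = "\<lambda>k. x \<le> sum_list (take k l)", OF le])
  have "k \<le> length l"
    unfolding k_def by (rule Least_le[where P = "\<lambda>k. x \<le> sum_list (take k l)", OF le])
  moreover obtain j where j: "k = Suc j"
    using k assms by (cases k) auto
  moreover have "\<not> x \<le> sum_list (take j l)"
    using j not_less_Least[of j "\<lambda>k. x \<le> sum_list (take k l)"] unfolding k_def by simp
  ultimately show ?thesis
    using that[of j] k by (simp add: young_block_def)
qed

lemma card_young_block: "j < length l \<Longrightarrow> card (young_block l j) = l ! j"
  by (simp add: young_block_def take_Suc_conv_app_nth)

lemma young_block_nonempty:
  assumes "l \<in> partitions n" "j < length l"
  shows "\<exists>x. x \<in> young_block l j"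
proof -
  have "l ! j \<in> set l"
    using assms(2) by simp
  moreover have "0 \<notin> set l"
    using assms(1) by (simp add: partitions_def)
  ultimately have "card (young_block l j) \<noteq> 0"
    unfolding card_young_block[OF assms(2)] by metis
  then show ?thesis
    by (metis card.empty ex_in_conv)
qed

lemma young_subgroup_id: "id \<in> young_subgroup n l"
  by (simp add: young_subgroup_def permutes_id)

lemma young_subgroup_subset: "young_subgroup n l \<subseteq> sym_group n"
  by (auto simp: young_subgroup_def)

lemma finite_young_subgroup: "finite (young_subgroup n l)"
  using finite_subset[OF young_subgroup_subset finite_permutations] by simp

lemma young_subgroup_inv_mem:
  assumes "w \<in> young_subgroup n l" "j < length l" "x \<in> young_block l j"
  shows "inv w x \<in> young_block l j"
proof -
  have w: "w permutes {1..n}" "w ` young_block l j = young_block l j"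
    using assms by (auto simp: young_subgroup_def)
  then obtain y where "y \<in> young_block l j" "x = w y"
    using assms(3) by blast
  then show ?thesis
    using permutes_inverses(2)[OF w(1)] by simp
qed

lemma young_subgroup_inv:
  assumes "a \<in> young_subgroup n l"
  shows "inv a \<in> young_subgroup n l"
proof -
  have a: "a permutes {1..n}"
    using assms by (simp add: young_subgroup_def)
  have "inv a ` young_block l j = young_block l j" if "j < length l" for j
    using image_inv_f_f[OF permutes_inj[OF a], of "young_block l j"] assms that
    by (simp add: young_subgroup_def)
  then show ?thesis
    using permutes_inv[OF a] by (simp add: young_subgroup_def)
qed

lemma adj_transp_comp_young_subgroup:
  assumes "w \<in> young_subgroup n l" "i \<in> {1..<n}" "i \<in> young_block l j" "Suc i \<in> young_block l j"
  shows "adj_transp i \<circ> w \<in> young_subgroup n l"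
proof -
  \<comment> \<open>Blocks are disjoint, so each contains both of \<open>i\<close> and
    \<open>Suc i\<close> or neither.\<close>
  have "adj_transp i ` young_block l k = young_block l k" for k
    using assms(3,4) young_block_unique by (metis transpose_image_eq)
  then have "(adj_transp i \<circ> w) ` young_block l k = young_block l k" if "k < length l" for k
    using assms(1) that unfolding image_comp[symmetric] by (simp add: young_subgroup_def)
  moreover have "adj_transp i \<circ> w permutes {1..n}"
    using assms(1,2) by (intro permutes_compose permutes_swap_id) (auto simp: young_subgroup_def)
  ultimately show ?thesis
    by (simp add: young_subgroup_def)
qed

text \<open>Elements of a Young subgroup keep the order of any two points in different blocks.\<close>

lemma young_subgroup_descent:
  assumes w: "w \<in> young_subgroup n l" and i: "i \<in> {1..<n}" and l: "sum_list l = n"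
    and less: "inv w (Suc i) < inv w i"
  shows "\<exists>j<length l. i \<in> young_block l j \<and> Suc i \<in> young_block l j"
proof -
  obtain j where j: "j < length l" "i \<in> young_block l j"
    using i l young_block_cover[of i l] by auto
  obtain k where k: "k < length l" "Suc i \<in> young_block l k"
    using i l young_block_cover[of "Suc i" l] by auto
  have mem: "inv w i \<in> young_block l j" "inv w (Suc i) \<in> young_block l k"
    using young_subgroup_inv_mem[OF w] j k by auto
  have "j = k"
  proof (rule ccontr)
    assume "j \<noteq> k"
    then consider "j < k" | "k < j"
      by linarith
    then show False
    proof cases
      case 1
      then show False
        using young_block_less[OF 1 mem] less by simp
    next
      case 2
      then show False
        using young_block_less[OF 2 k(2) j(2)] by simp
    qed
  qed
  with j k show ?thesis
    by blast
qed

section \<open>Permutations whose cycles are the blocks of a partition\<close>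

definition interval_cycle :: "nat \<Rightarrow> nat \<Rightarrow> nat \<Rightarrow> nat" where
  "interval_cycle a b x = (if x = b then Suc a else Suc x)"

lemma bij_betw_interval_cycle: "bij_betw (interval_cycle a b) {a<..b} {a<..b}"
proof -
  have "inj_on (interval_cycle a b) {a<..b}"
    by (auto simp: inj_on_def interval_cycle_def split: if_splits)
  moreover have "interval_cycle a b ` {a<..b} \<subseteq> {a<..b}"
    by (auto simp: interval_cycle_def)
  ultimately show ?thesis
    by (simp add: bij_betw_def endo_inj_surj)
qed

text \<open>From \<open>x\<close> the cycle climbs to \<open>b\<close>, wraps around to
  \<open>Suc a\<close>, and from there climbs through the whole interval.\<close>

lemma interval_cycle_transitive:
  assumes stable: "\<And>x. x \<in> A \<Longrightarrow> x \<in> {a<..b} \<Longrightarrow> interval_cycle a b x \<in> A"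
    and x: "x \<in> A" "x \<in> {a<..b}"
  shows "{a<..b} \<subseteq> A"
proof -
  have up: "x + k \<in> A" if "x \<in> A" "a < x" "x + k \<le> b" for x k
    using that
  proof (induction k)
    case (Suc k)
    then have "interval_cycle a b (x + k) \<in> A"
      by (intro stable) auto
    with Suc.prems show ?case
      by (simp add: interval_cycle_def)
  qed simp
  have "b \<in> A"
    using up[of x "b - x"] x by simp
  then have "Suc a \<in> A"
    using stable[of b] x by (auto simp: interval_cycle_def)
  show ?thesis
  proof
    fix y
    assume "y \<in> {a<..b}"
    then show "y \<in> A"
      using up[OF \<open>Suc a \<in> A\<close>, of "y - Suc a"] by simp
  qed
qed

text \<open>A representative of the conjugacy class with cycle type \<open>l\<close>; fixing all
  points outside \<open>{1..sum_list l}\<close> makes it a permutation in the sense of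
  \<open>permutes\<close>.\<close>

definition block_cycle :: "nat list \<Rightarrow> nat \<Rightarrow> nat" where
  "block_cycle l x =
     (if x \<in> {1..sum_list l} then
        let j = THE j. x \<in> young_block l j
        in interval_cycle (sum_list (take j l)) (sum_list (take (Suc j) l)) x
      else x)"

lemma block_cycle_eq:
  assumes "x \<in> young_block l j"
  shows "block_cycle l x = interval_cycle (sum_list (take j l)) (sum_list (take (Suc j) l)) x"
proof -
  have "(THE j. x \<in> young_block l j) = j"
    using assms young_block_unique by blast
  with assms young_block_subset[of l j] show ?thesis
    by (auto simp: block_cycle_def)
qed

lemma bij_betw_block_cycle: "bij_betw (block_cycle l) (young_block l j) (young_block l j)"
  using bij_betw_interval_cycle[of "sum_list (take j l)" "sum_list (take (Suc j) l)"]
  by (subst bij_betw_cong[OF block_cycle_eq]) (auto simp: young_block_def)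

lemma block_cycle_young_subgroup:
  assumes "sum_list l = n"
  shows "block_cycle l \<in> young_subgroup n l"
proof -
  have image: "block_cycle l ` young_block l j = young_block l j" for j
    using bij_betw_block_cycle by (rule bij_betw_imp_surj_on)
  have "inj_on (block_cycle l) {1..n}"
  proof (rule inj_onI)
    fix x y
    assume xy: "x \<in> {1..n}" "y \<in> {1..n}" "block_cycle l x = block_cycle l y"
    obtain j where j: "x \<in> young_block l j"
      using young_block_cover xy(1) assms by metis
    obtain k where k: "y \<in> young_block l k"
      using young_block_cover xy(2) assms by metis
    have "block_cycle l x \<in> young_block l j" "block_cycle l y \<in> young_block l k"
      using j k image by blast+
    then have "j = k"
      using xy(3) young_block_unique by metis
    then show "x = y"
      using j k xy(3) bij_betw_imp_inj_on[OF bij_betw_block_cycle] by (metis inj_onD)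
  qed
  moreover have "block_cycle l ` {1..n} \<subseteq> {1..n}"
  proof clarify
    fix x
    assume "x \<in> {1..n}"
    then obtain j where "x \<in> young_block l j"
      using young_block_cover assms by metis
    then show "block_cycle l x \<in> {1..n}"
      using image young_block_subset assms by blast
  qed
  ultimately have "bij_betw (block_cycle l) {1..n} {1..n}"
    by (simp add: bij_betw_def endo_inj_surj)
  then have "block_cycle l permutes {1..n}"
    by (rule bij_imp_permutes) (use assms in \<open>auto simp: block_cycle_def\<close>)
  with image show ?thesis
    by (simp add: young_subgroup_def)
qed

lemma block_cycle_transitive:
  assumes "\<And>x. x \<in> A \<Longrightarrow> block_cycle l x \<in> A" "x \<in> A" "x \<in> young_block l j"
  shows "young_block l j \<subseteq> A"
  unfolding young_block_def
proof (rule interval_cycle_transitive)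
  fix x
  assume x: "x \<in> A" "x \<in> {sum_list (take j l)<..sum_list (take (Suc j) l)}"
  show "interval_cycle (sum_list (take j l)) (sum_list (take (Suc j) l)) x \<in> A"
    using assms(1)[OF x(1)] block_cycle_eq[of x l j] x(2) by (simp add: young_block_def)
qed (use assms in \<open>auto simp: young_block_def\<close>)

text \<open>
  The hypothesis says that \<open>w\<close> conjugates \<open>block_cycle m\<close> into the Young subgroup of \<open>l\<close>, so
  each \<open>w\<close>-translate of a block of \<open>l\<close> is a union of blocks of \<open>m\<close>.
\<close>

lemma block_cycle_conjugate_young_subgroup:
  assumes l: "l \<in> partitions n" and m: "m \<in> partitions n"
    and w: "w \<in> sym_group n" and u: "u \<in> young_subgroup n l"
    and eq: "block_cycle m \<circ> (w \<circ> u) = w"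
  shows "length l < length m \<or> l = m"
proof -
  have sum: "sum_list l = n" "sum_list m = n"
    using l m by (auto simp: partitions_def)
  have w: "w permutes {1..n}" and u': "u permutes {1..n}"
    using w u by (auto simp: young_subgroup_def)
  have "\<exists>j<length l. young_block m k \<subseteq> w ` young_block l j" if k: "k < length m" for k
  proof -
    obtain x where x: "x \<in> young_block m k"
      using young_block_nonempty[OF m k] by blast
    then have "inv w x \<in> {1..sum_list l}"
      using young_block_subset[of m k] sum permutes_in_image[OF permutes_inv[OF w]] by auto
    then obtain j where j: "j < length l" "inv w x \<in> young_block l j"
      using young_block_cover by blast
    have "young_block m k \<subseteq> w ` young_block l j"
    proof (rule block_cycle_transitive)
      show "x \<in> w ` young_block l j"
        using j permutes_inverses(1)[OF w] by (metis image_eqI)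
    next
      fix y
      assume "y \<in> w ` young_block l j"
      then obtain z where z: "z \<in> young_block l j" "y = w z"
        by blast
      have "block_cycle m y = (block_cycle m \<circ> (w \<circ> u)) (inv u z)"
        using permutes_inverses(1)[OF u'] z by simp
      also have "\<dots> = w (inv u z)"
        by (simp only: eq)
      finally show "block_cycle m y \<in> w ` young_block l j"
        using young_subgroup_inv_mem[OF u j(1) z(1)] by simp
    qed (fact x)
    with j show ?thesis
      by blast
  qed
  then obtain \<phi> where \<phi>: "\<And>k. k < length m \<Longrightarrow> \<phi> k < length l"
      "\<And>k. k < length m \<Longrightarrow> young_block m k \<subseteq> w ` young_block l (\<phi> k)"
    by metis
  have preimage: "\<exists>k<length m. w x \<in> young_block m k \<and> \<phi> k = j" if "x \<in> young_block l j" for x j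
  proof -
    have "x \<in> {1..n}"
      using young_block_subset that sum by blast
    then have "w x \<in> {1..sum_list m}"
      using permutes_in_image[OF w] sum by auto
    then obtain k where k: "k < length m" "w x \<in> young_block m k"
      using young_block_cover by blast
    then obtain x' where "x' \<in> young_block l (\<phi> k)" "w x = w x'"
      using \<phi>(2) by blast
    then have "x \<in> young_block l (\<phi> k)"
      using permutes_inj[OF w] by (simp add: inj_eq)
    with k that show ?thesis
      using young_block_unique by blast
  qed
  \<comment> \<open>Every block of \<open>l\<close> is nonempty, so its translate meets, and hence
    contains, some block of \<open>m\<close>.\<close>
  have surj: "{..<length l} \<subseteq> \<phi> ` {..<length m}"
  proof
    fix j
    assume j: "j \<in> {..<length l}"
    then obtain x where "x \<in> young_block l j"
      using young_block_nonempty[OF l] by blast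
    with preimage show "j \<in> \<phi> ` {..<length m}"
      by blast
  qed
  then have le: "length l \<le> length m"
    using surj_card_le[OF _ surj] by simp
  show ?thesis
  proof (cases "length l = length m")
    case False
    with le show ?thesis
      by simp
  next
    case True
    \<comment> \<open>Equal lengths make \<open>\<phi>\<close> a bijection. Each translated block of
      \<open>l\<close> then contains just one block of \<open>m\<close>, so the two coincide and the
      parts agree up to order.\<close>
    have image: "\<phi> ` {..<length m} = {..<length m}"
      using surj \<phi>(1) True by auto
    then have inj: "inj_on \<phi> {..<length m}"
      by (intro eq_card_imp_inj_on) auto
    have nth: "l ! \<phi> k = m ! k" if k: "k < length m" for k
    proof -
      have "w ` young_block l (\<phi> k) \<subseteq> young_block m k"
      proof clarify
        fix x
        assume "x \<in> young_block l (\<phi> k)"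
        then obtain k' where "k' < length m" "w x \<in> young_block m k'" "\<phi> k' = \<phi> k"
          using preimage by blast
        then show "w x \<in> young_block m k"
          using inj k by (auto dest: inj_onD)
      qed
      with \<phi>(2)[OF k] have "young_block m k = w ` young_block l (\<phi> k)"
        by blast
      then have "card (young_block m k) = card (young_block l (\<phi> k))"
        using card_image[OF inj_on_subset[OF permutes_inj_on[OF w] subset_UNIV]] by metis
      then show ?thesis
        using card_young_block k \<phi>(1) by metis
    qed
    have mset_nth: "mset xs = image_mset ((!) xs) (mset_set {..<length xs})" for xs :: "nat list"
      by (metis map_nth mset_map mset_upt atLeast0LessThan)
    have "mset m = image_mset ((!) l) (image_mset \<phi> (mset_set {..<length m}))"
      unfolding mset_nth[of m] multiset.map_comp by (rule image_mset_cong) (simp add: nth)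
    also have "\<dots> = mset l"
      by (simp add: image_mset_mset_set[OF inj] image mset_nth[of l] True)
    finally have "mset l = mset m"
      by simp
    then show ?thesis
      using partitions_mset_eq[OF l m] by simp
  qed
qed

section \<open>Induced sign characters of the Hecke algebra\<close>

lemma qvar_nonzero: "qvar \<noteq> 0"
  using value_at_one_unique[OF value_at_one_qvar] value_at_one_const(1) by force

text \<open>The Poincare polynomial of the Young subgroup at the inverse of q. It normalises the
  antisymmetrizer to an idempotent, and its value at q = 1 is the order of the subgroup.\<close>

definition poincare :: "nat \<Rightarrow> nat list \<Rightarrow> ratq" where
  "poincare n l = (\<Sum>u\<in>young_subgroup n l. inverse qvar ^ coxeter_length n u)"

lemma card_young_subgroup_nonzero: "card (young_subgroup n l) \<noteq> 0"
  using young_subgroup_id[of n l] finite_young_subgroup[of n l] by (metis card_0_eq empty_iff)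

lemma value_at_one_poincare: "value_at_one (poincare n l) (of_nat (card (young_subgroup n l)))"
proof -
  have "value_at_one (inverse qvar ^ k) 1" for k
    using value_at_one_power[OF value_at_one_inverse[OF value_at_one_qvar], of k] by simp
  then have "value_at_one (poincare n l) (\<Sum>u\<in>young_subgroup n l. 1)"
    unfolding poincare_def by (intro value_at_one_sum)
  then show ?thesis
    by simp
qed

lemma poincare_nonzero: "poincare n l \<noteq> 0"
  using value_at_one_unique[OF value_at_one_poincare[of n l], of 0] value_at_one_const(1)
    card_young_subgroup_nonzero[of n l] by auto

context hecke_algebra
begin

lemma finite_sym_group: "finite (sym_group n)"
  by (rule finite_permutations) simp

definition coef :: "(nat \<Rightarrow> nat) \<Rightarrow> 'h \<Rightarrow> ratq" where
  "coef w h = representation (T ` sym_group n) h (T w)"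

lemma coef_add: "coef w (x + y) = coef w x + coef w y"
  unfolding coef_def by (subst representation_add[OF T_independent]) (simp_all only: T_span UNIV_I)

lemma coef_scale: "coef w (scale c x) = c * coef w x"
  unfolding coef_def by (subst representation_scale[OF T_independent]) (simp_all only: T_span UNIV_I)

lemma coef_sum: "coef w (sum f A) = (\<Sum>a\<in>A. coef w (f a))"
  unfolding coef_def by (subst representation_sum[OF T_independent]) (simp_all only: T_span UNIV_I)

lemma coef_T:
  assumes "w \<in> sym_group n" "x \<in> sym_group n"
  shows "coef w (T x) = (if w = x then 1 else 0)"
  unfolding coef_def using assms representation_basis[OF T_independent, of "T x"] T_inj
  by (auto simp: inj_on_eq_iff)

lemma sum_coef: "(\<Sum>w\<in>sym_group n. scale (coef w h) (T w)) = h"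
proof -
  have "h \<in> span (T ` sym_group n)"
    by (simp only: T_span UNIV_I)
  from sum_representation_eq[OF finite_imageI[OF finite_sym_group] T_independent this]
  show ?thesis
    unfolding coef_def by (subst (asm) sum.reindex[OF T_inj]) (simp only: o_def)
qed

lemma T_id: "T id = 1"
proof -
  have "reduced_expression n id []"
    by (simp add: reduced_expression_def is_expression_def word_perm_simps coxeter_length_id)
  then show ?thesis
    using T_reduced[of id "[]"] by (simp add: permutes_id)
qed

lemma T_adj_mult_up:
  assumes "w \<in> sym_group n" "i \<in> {1..<n}"
    and "coxeter_length n (adj_transp i \<circ> w) = Suc (coxeter_length n w)"
  shows "T (adj_transp i) * T w = T (adj_transp i \<circ> w)"
proof -
  obtain "is" where "is": "reduced_expression n w is"
    using reduced_expression_exists assms(1) by blast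
  show ?thesis
    using T_reduced[OF assms(1) "is"]
      T_reduced[OF adj_transp_comp_sym_group[OF assms(2,1)] reduced_expression_Cons[OF assms(2) "is" assms(3)]]
    by simp
qed

text \<open>Here \<open>T w\<close> factors as
  \<open>T (adj_transp i) * T (adj_transp i \<circ> w)\<close>, and the quadratic relation applies
  to the squared generator.\<close>

lemma T_adj_mult_down:
  assumes "w \<in> sym_group n" "i \<in> {1..<n}"
    and "coxeter_length n w = Suc (coxeter_length n (adj_transp i \<circ> w))"
  shows "T (adj_transp i) * T w = scale (qvar - 1) (T w) + scale qvar (T (adj_transp i \<circ> w))"
proof -
  have Tw: "T w = T (adj_transp i) * T (adj_transp i \<circ> w)"
    using T_adj_mult_up[OF adj_transp_comp_sym_group[OF assms(2,1)] assms(2)] assms(3)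
    by (simp only: adj_transp_comp_cancel)
  have "T (adj_transp i) * T w = (T (adj_transp i) * T (adj_transp i)) * T (adj_transp i \<circ> w)"
    by (simp add: Tw mult.assoc)
  also have "\<dots> = scale (qvar - 1) (T w) + scale qvar (T (adj_transp i \<circ> w))"
    by (simp add: quadratic[OF assms(2)] distrib_right scale_mult_left Tw)
  finally show ?thesis .
qed

section \<open>Sign idempotents of Young subgroups\<close>

definition antisymmetrizer :: "nat list \<Rightarrow> 'h" where
  "antisymmetrizer l =
     (\<Sum>u\<in>young_subgroup n l. scale ((- inverse qvar) ^ coxeter_length n u) (T u))"

text \<open>Left multiplication by the generator pairs up the Young subgroup, and the coefficients
  of \<open>antisymmetrizer\<close> are chosen so that the contributions of each pair to
  \<open>T (adj_transp i) * antisymmetrizer l + antisymmetrizer l\<close> cancel.\<close>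

lemma T_adj_antisymmetrizer:
  assumes i: "i \<in> {1..<n}" "i \<in> young_block l j" "Suc i \<in> young_block l j"
  shows "T (adj_transp i) * antisymmetrizer l = - antisymmetrizer l"
proof -
  let ?s = "adj_transp i"
  let ?c = "\<lambda>u. (- inverse qvar) ^ coxeter_length n u"
  let ?g = "\<lambda>u. scale (?c u) (T ?s * T u + T u)"
  \<comment> \<open>Both terms are multiples of \<open>T u + T (?s \<circ> u)\<close>; the extra
    factor \<open>- inverse qvar\<close> meets a factor \<open>qvar\<close> from the quadratic
    relation, so the coefficients are opposite.\<close>
  have pair: "?g u + ?g (?s \<circ> u) = 0"
    if u: "u \<in> sym_group n" and len: "coxeter_length n (?s \<circ> u) = Suc (coxeter_length n u)" for u
  proof -
    have su: "?s \<circ> u \<in> sym_group n"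
      using adj_transp_comp_sym_group[OF i(1) u] .
    have "T ?s * T (?s \<circ> u) = scale (qvar - 1) (T (?s \<circ> u)) + scale qvar (T u)"
      using T_adj_mult_down[OF su i(1)] len by (simp only: adj_transp_comp_cancel)
    then have "T ?s * T (?s \<circ> u) + T (?s \<circ> u) = scale qvar (T (?s \<circ> u) + T u)"
      by (simp add: scale_left_diff_distrib scale_right_distrib)
    moreover have "?c (?s \<circ> u) * qvar = - ?c u"
      using qvar_nonzero by (simp add: len)
    ultimately have "?g (?s \<circ> u) = scale (- ?c u) (T (?s \<circ> u) + T u)"
      by (metis scale_scale)
    then show ?thesis
      by (simp add: T_adj_mult_up[OF u i(1) len])
  qed
  have all: "?g u + ?g (?s \<circ> u) = 0" if "u \<in> young_subgroup n l" for u
  proof -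
    have u: "u \<in> sym_group n"
      using that young_subgroup_subset by blast
    from u i(1) show ?thesis
    proof (cases rule: coxeter_length_adj_transp_cases)
      case up
      with u show ?thesis
        by (rule pair)
    next
      case down
      then have "?g (?s \<circ> u) + ?g (?s \<circ> (?s \<circ> u)) = 0"
        by (intro pair adj_transp_comp_sym_group i u) (simp only: adj_transp_comp_cancel)
      then show ?thesis
        by (simp only: adj_transp_comp_cancel add.commute)
    qed
  qed
  have "bij_betw (\<lambda>u. ?s \<circ> u) (young_subgroup n l) (young_subgroup n l)"
    by (rule bij_betwI[where g = "\<lambda>u. ?s \<circ> u"])
      (use adj_transp_comp_young_subgroup[OF _ i] in \<open>auto simp only: adj_transp_comp_cancel\<close>)
  then have "(\<Sum>u\<in>young_subgroup n l. ?g (?s \<circ> u)) = (\<Sum>u\<in>young_subgroup n l. ?g u)"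
    by (rule sum.reindex_bij_betw)
  then have "(\<Sum>u\<in>young_subgroup n l. ?g u) + (\<Sum>u\<in>young_subgroup n l. ?g u)
      = (\<Sum>u\<in>young_subgroup n l. ?g u + ?g (?s \<circ> u))"
    by (simp only: sum.distrib)
  also have "\<dots> = 0"
    by (rule sum.neutral) (use all in blast)
  finally have "scale (1 + 1) (\<Sum>u\<in>young_subgroup n l. ?g u) = 0"
    by (simp only: scale_left_distrib scale_one)
  \<comment> \<open>Each pair was counted twice, so 2 must be invertible; its value at q = 1 is
    nonzero.\<close>
  moreover have "(1 + 1 :: ratq) \<noteq> 0"
    using value_at_one_unique[OF value_at_one_add[OF value_at_one_const(2,2)]] value_at_one_const(1)
    by force
  ultimately have "(\<Sum>u\<in>young_subgroup n l. ?g u) = 0"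
    by simp
  then have "T ?s * antisymmetrizer l + antisymmetrizer l = 0"
    by (simp add: antisymmetrizer_def sum_distrib_left scale_mult_right scale_right_distrib sum.distrib)
  then show ?thesis
    by (simp add: eq_neg_iff_add_eq_0)
qed

text \<open>Induction on length. A left descent of \<open>u\<close> exchanges two points of one
  block, so removing it stays inside the Young subgroup and contributes one sign.\<close>

lemma T_young_antisymmetrizer:
  assumes "sum_list l = n" "u \<in> young_subgroup n l"
  shows "T u * antisymmetrizer l = scale ((-1) ^ coxeter_length n u) (antisymmetrizer l)"
  using assms(2)
proof (induction "coxeter_length n u" arbitrary: u rule: less_induct)
  case less
  have u: "u \<in> sym_group n"
    using less.prems young_subgroup_subset by blast
  show ?case
  proof (cases "u = id")
    case True
    then show ?thesis
      by (simp add: T_id coxeter_length_id)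
  next
    case False
    then obtain i where i: "i \<in> {1..<n}" "inv u (Suc i) < inv u i"
      using left_descent_exists u by blast
    obtain j where j: "i \<in> young_block l j" "Suc i \<in> young_block l j"
      using young_subgroup_descent[OF less.prems i(1) assms(1) i(2)] by blast
    let ?v = "adj_transp i \<circ> u"
    note v = adj_transp_comp_young_subgroup[OF less.prems i(1) j]
    note len = coxeter_length_adj_transp(2)[OF u i]
    have "T u = T (adj_transp i) * T ?v"
      using T_adj_mult_up[OF adj_transp_comp_sym_group[OF i(1) u] i(1)] len
      by (simp only: adj_transp_comp_cancel)
    moreover have "T ?v * antisymmetrizer l = scale ((-1) ^ coxeter_length n ?v) (antisymmetrizer l)"
      by (rule less.hyps[OF _ v]) (simp add: len)
    ultimately show ?thesis
      by (simp add: mult.assoc scale_mult_right T_adj_antisymmetrizer[OF i(1) j] len)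
  qed
qed

definition sign_idempotent :: "nat list \<Rightarrow> 'h" where
  "sign_idempotent l = scale (inverse (poincare n l)) (antisymmetrizer l)"

lemma T_young_sign_idempotent:
  assumes "sum_list l = n" "u \<in> young_subgroup n l"
  shows "T u * sign_idempotent l = scale ((-1) ^ coxeter_length n u) (sign_idempotent l)"
  by (simp add: sign_idempotent_def scale_mult_right T_young_antisymmetrizer[OF assms] mult.commute)

lemma subspace_left_annihilator: "subspace {x. x * y = 0}"
  by (rule subspaceI) (auto simp: distrib_right scale_mult_left)

text \<open>Modulo the relations, \<open>T u\<close> acts from the right by its sign. The
  antisymmetrizer therefore acts as the scalar \<open>poincare n l\<close>, and its normalised
  multiple as 1.\<close>

lemma diff_sign_idempotent_mem: "x - x * sign_idempotent l \<in> induced_relations l"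
proof -
  let ?c = "\<lambda>u. inverse qvar ^ coxeter_length n u"
  let ?r = "\<lambda>u. x * T u - scale ((-1) ^ coxeter_length n u) x"
  have c: "(- inverse qvar) ^ coxeter_length n u * (-1) ^ coxeter_length n u = ?c u" for u
    by (simp flip: power_mult_distrib)
  have "(\<Sum>u\<in>young_subgroup n l. scale ((- inverse qvar) ^ coxeter_length n u) (?r u))
      = x * antisymmetrizer l - scale (poincare n l) x"
    by (simp add: antisymmetrizer_def poincare_def sum_distrib_left scale_mult_right
        scale_right_diff_distrib sum_subtractf c scale_sum_left)
  then have "x - x * sign_idempotent l
      = - scale (inverse (poincare n l))
          (\<Sum>u\<in>young_subgroup n l. scale ((- inverse qvar) ^ coxeter_length n u) (?r u))"
    by (simp add: sign_idempotent_def scale_mult_right scale_right_diff_distrib poincare_nonzero)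
  then show ?thesis
    unfolding induced_relations_def
    by (auto intro!: span_neg span_scale span_sum intro: span_base)
qed

text \<open>The idempotent turns \<open>T u\<close> on its left into a sign, which kills each
  relation. Conversely an annihilated \<open>x\<close> equals
  \<open>x - x * sign_idempotent l\<close>, which lies in the relations.\<close>

lemma induced_relations_eq:
  assumes "sum_list l = n"
  shows "induced_relations l = {x. x * sign_idempotent l = 0}"
proof
  have "h * T u - scale ((-1) ^ coxeter_length n u) h \<in> {x. x * sign_idempotent l = 0}"
    if "u \<in> young_subgroup n l" for h u
    by (simp add: left_diff_distrib mult.assoc T_young_sign_idempotent[OF assms that]
        scale_mult_left scale_mult_right)
  then show "induced_relations l \<subseteq> {x. x * sign_idempotent l = 0}"
    unfolding induced_relations_def by (intro span_minimal subspace_left_annihilator) blast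
next
  show "{x. x * sign_idempotent l = 0} \<subseteq> induced_relations l"
  proof clarify
    fix x
    assume "x * sign_idempotent l = 0"
    then show "x \<in> induced_relations l"
      using diff_sign_idempotent_mem[of x l] by simp
  qed
qed

lemma sign_idempotent_idem:
  assumes "sum_list l = n"
  shows "sign_idempotent l * sign_idempotent l = sign_idempotent l"
  using diff_sign_idempotent_mem[of 1 l] unfolding induced_relations_eq[OF assms]
  by (simp add: left_diff_distrib)

text \<open>Right multiplication by the idempotent is a projection, its kernel is the space of
  relations, and it commutes with left multiplication by \<open>g\<close>; so
  \<open>quotient_trace_projection\<close> applies.\<close>

lemma induced_sign_character_eq:
  assumes "sum_list l = n"
  shows "induced_sign_character l g = (\<Sum>w\<in>sym_group n. coef w (g * (T w * sign_idempotent l)))"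
proof -
  have lin: "Vector_Spaces.linear scale scale (\<lambda>x. g * x)" for g
    by (intro Vector_Spaces.linear.intro vector_space_axioms module_hom.intro module_axioms
        module_hom_axioms.intro) (auto simp: distrib_left scale_mult_right)
  have "Vector_Spaces.linear scale scale (\<lambda>x. x * sign_idempotent l)"
    by (intro Vector_Spaces.linear.intro vector_space_axioms module_hom.intro module_axioms
        module_hom_axioms.intro) (auto simp: distrib_right scale_mult_left)
  from quotient_trace_projection[OF vector_space_axioms _ T_independent T_span lin this]
  show ?thesis
    unfolding induced_sign_character_def induced_relations_eq[OF assms] coef_def
    using finite_sym_group sum.reindex[OF T_inj]
    by (simp add: mult.assoc sign_idempotent_idem[OF assms])
qed

lemma linear_induced_sign_character:
  assumes "sum_list l = n"
  shows "Vector_Spaces.linear scale (*) (induced_sign_character l)"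
proof -
  interpret ratq: vector_space "(*) :: ratq \<Rightarrow> ratq \<Rightarrow> ratq"
    by unfold_locales (auto simp: algebra_simps)
  show ?thesis
    by (intro Vector_Spaces.linear.intro vector_space_axioms module_hom.intro module_axioms
        module_hom_axioms.intro ratq.vector_space_axioms ratq.module_axioms)
      (auto simp: induced_sign_character_eq[OF assms] distrib_right scale_mult_left coef_add
        coef_scale sum.distrib sum_distrib_left)
qed

text \<open>At \<open>q = 1\<close> the element \<open>h\<close> specialises to the permutation \<open>x\<close> in the group algebra.\<close>

definition specializes_to :: "'h \<Rightarrow> (nat \<Rightarrow> nat) \<Rightarrow> bool" where
  "specializes_to h x \<longleftrightarrow>
     x \<in> sym_group n \<and> (\<forall>w\<in>sym_group n. value_at_one (coef w h) (if w = x then 1 else 0))"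

lemma specializes_to_T: "x \<in> sym_group n \<Longrightarrow> specializes_to (T x) x"
  unfolding specializes_to_def using coef_T value_at_one_const by simp

lemma specializes_to_adj_mult_T:
  assumes x: "x \<in> sym_group n" and i: "i \<in> {1..<n}"
  shows "specializes_to (T (adj_transp i) * T x) (adj_transp i \<circ> x)"
proof -
  have sx: "adj_transp i \<circ> x \<in> sym_group n"
    using adj_transp_comp_sym_group[OF i x] .
  from x i show ?thesis
  proof (cases rule: coxeter_length_adj_transp_cases)
    case up
    then show ?thesis
      using specializes_to_T[OF sx] by (simp add: T_adj_mult_up[OF x i])
  next
    case down
    have "value_at_one (coef w (T (adj_transp i) * T x)) (if w = adj_transp i \<circ> x then 1 else 0)"
      if w: "w \<in> sym_group n" for w
    proof -
      \<comment> \<open>The quadratic relation differs from a group relation by a term with factor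
        \<open>qvar - 1\<close>, which vanishes at 1.\<close>
      have "value_at_one ((qvar - 1) * coef w (T x) + qvar * coef w (T (adj_transp i \<circ> x)))
          ((1 - 1) * (if w = x then 1 else 0) + 1 * (if w = adj_transp i \<circ> x then 1 else 0))"
        using specializes_to_T[OF x] specializes_to_T[OF sx] w unfolding specializes_to_def
        by (intro value_at_one_add value_at_one_mult value_at_one_diff value_at_one_qvar value_at_one_const) auto
      then show ?thesis
        by (simp add: T_adj_mult_down[OF x i down] coef_add coef_scale)
    qed
    with sx show ?thesis
      by (simp add: specializes_to_def)
  qed
qed

lemma specializes_to_adj_mult:
  assumes h: "specializes_to h x" and i: "i \<in> {1..<n}"
  shows "specializes_to (T (adj_transp i) * h) (adj_transp i \<circ> x)"
proof -
  have x: "x \<in> sym_group n"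
    using h by (simp add: specializes_to_def)
  have "value_at_one (coef w (T (adj_transp i) * h)) (if w = adj_transp i \<circ> x then 1 else 0)"
    if w: "w \<in> sym_group n" for w
  proof -
    have "T (adj_transp i) * h = (\<Sum>y\<in>sym_group n. scale (coef y h) (T (adj_transp i) * T y))"
      by (subst sum_coef[of h, symmetric]) (simp add: sum_distrib_left scale_mult_right)
    then have "coef w (T (adj_transp i) * h)
        = (\<Sum>y\<in>sym_group n. coef y h * coef w (T (adj_transp i) * T y))"
      by (simp add: coef_sum coef_scale)
    moreover have "value_at_one (\<Sum>y\<in>sym_group n. coef y h * coef w (T (adj_transp i) * T y))
        (\<Sum>y\<in>sym_group n. (if y = x then 1 else 0) * (if w = adj_transp i \<circ> y then 1 else 0))"
      using h specializes_to_adj_mult_T[OF _ i] w unfolding specializes_to_def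
      by (intro value_at_one_sum value_at_one_mult) auto
    moreover have "(\<Sum>y\<in>sym_group n. (if y = x then 1 else 0) * (if w = adj_transp i \<circ> y then 1 else 0))
        = (\<Sum>y\<in>sym_group n. if y = x then if w = adj_transp i \<circ> y then 1 else 0 else (0 :: rat))"
      by (rule sum.cong) auto
    ultimately show ?thesis
      using x finite_sym_group by simp
  qed
  then show ?thesis
    using adj_transp_comp_sym_group[OF i x] by (simp add: specializes_to_def)
qed

text \<open>\<open>T a\<close> is multiplied on one generator at a time along a reduced word of
  \<open>a\<close>.\<close>

lemma specializes_to_mult:
  assumes "a \<in> sym_group n" "specializes_to h x"
  shows "specializes_to (T a * h) (a \<circ> x)"
proof -
  have word: "set is \<subseteq> {1..<n} \<Longrightarrow>
      specializes_to (prod_list (map (\<lambda>i. T (adj_transp i)) is) * h) (word_perm is \<circ> x)" for "is"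
  proof (induction "is")
    case (Cons i "is")
    then have "specializes_to (T (adj_transp i) * (prod_list (map (\<lambda>i. T (adj_transp i)) is) * h))
        (adj_transp i \<circ> (word_perm is \<circ> x))"
      by (intro specializes_to_adj_mult) (simp_all only: list.set insert_subset simp_thms)
    then show ?case
      by (simp only: list.map prod_list.Cons mult.assoc comp_assoc word_perm_simps)
  qed (use assms in \<open>simp add: word_perm_simps\<close>)
  obtain "is" where "is": "reduced_expression n a is"
    using reduced_expression_exists assms(1) by blast
  then show ?thesis
    using word[of "is"] T_reduced[OF assms(1) "is"]
    by (simp add: reduced_expression_def is_expression_def)
qed

text \<open>Divided by the order of the Young subgroup, this is the induced sign character of the
  symmetric group at a permutation \<open>a\<close> in \<open>sym_group n\<close>: the equation
  forces \<open>u\<close> to be \<open>inv w \<circ> inv a \<circ> w\<close>, whose sign is that of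
  \<open>a\<close>.\<close>

definition sign_count :: "nat list \<Rightarrow> (nat \<Rightarrow> nat) \<Rightarrow> rat" where
  "sign_count l a = (\<Sum>w\<in>sym_group n. \<Sum>u\<in>young_subgroup n l.
     (-1) ^ coxeter_length n u * (if w = a \<circ> (w \<circ> u) then 1 else 0))"

text \<open>The antisymmetrizer is expanded and each product of basis elements specialises to a
  permutation. Dividing by \<open>poincare n l\<close> creates no pole, since its value at 1 is
  nonzero.\<close>

lemma value_at_one_induced_sign_character:
  assumes "sum_list l = n" "a \<in> sym_group n"
  shows "value_at_one (induced_sign_character l (T a)) (sign_count l a / of_nat (card (young_subgroup n l)))"
proof -
  let ?Y = "young_subgroup n l"
  let ?c = "\<lambda>u. (- inverse qvar) ^ coxeter_length n u"
  have "T a * (T w * sign_idempotent l)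
      = scale (inverse (poincare n l)) (\<Sum>u\<in>?Y. scale (?c u) (T a * (T w * T u)))" for w
    by (simp add: sign_idempotent_def antisymmetrizer_def sum_distrib_left scale_mult_right)
  then have eq: "induced_sign_character l (T a)
      = inverse (poincare n l) * (\<Sum>w\<in>sym_group n. \<Sum>u\<in>?Y. ?c u * coef w (T a * (T w * T u)))"
    by (simp add: induced_sign_character_eq[OF assms(1)] coef_scale coef_sum sum_distrib_left)
  have c: "value_at_one (- inverse qvar) (-1)"
    using value_at_one_mult[OF value_at_one_const(3) value_at_one_inverse[OF value_at_one_qvar]] by simp
  have "value_at_one (coef w (T a * (T w * T u))) (if w = a \<circ> (w \<circ> u) then 1 else 0)"
    if "w \<in> sym_group n" "u \<in> ?Y" for w u
  proof -
    have "u \<in> sym_group n"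
      using that young_subgroup_subset by blast
    then have "specializes_to (T a * (T w * T u)) (a \<circ> (w \<circ> u))"
      using that(1) assms(2) by (intro specializes_to_mult specializes_to_T)
    with that(1) show ?thesis
      unfolding specializes_to_def by blast
  qed
  then have "value_at_one (\<Sum>w\<in>sym_group n. \<Sum>u\<in>?Y. ?c u * coef w (T a * (T w * T u))) (sign_count l a)"
    unfolding sign_count_def by (intro value_at_one_sum value_at_one_mult value_at_one_power c)
  from value_at_one_mult[OF value_at_one_inverse[OF value_at_one_poincare] this] show ?thesis
    unfolding eq using card_young_subgroup_nonzero by (simp add: divide_inverse mult.commute)
qed

lemma sign_count_eq_0:
  assumes "l \<in> partitions n" "m \<in> partitions n" "\<not> length l < length m" "l \<noteq> m"
  shows "sign_count l (block_cycle m) = 0"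
  unfolding sign_count_def
proof (intro sum.neutral ballI)
  fix w u
  assume "w \<in> sym_group n" "u \<in> young_subgroup n l"
  then have "w \<noteq> block_cycle m \<circ> (w \<circ> u)"
    using block_cycle_conjugate_young_subgroup[OF assms(1,2)] assms(3,4) by metis
  then show "(-1) ^ coxeter_length n u * (if w = block_cycle m \<circ> (w \<circ> u) then 1 else 0) = (0 :: rat)"
    by (simp only: if_False mult_zero_right)
qed

text \<open>
  If \<open>w = a w u\<close> then \<open>u\<close> has the same sign as \<open>a\<close>, so all contributions have the same sign;
  for \<open>a\<close> in the Young subgroup, \<open>w = id\<close> contributes.
\<close>

lemma sign_count_nonzero:
  assumes a: "a \<in> young_subgroup n l"
  shows "sign_count l a \<noteq> 0"
proof -
  let ?Y = "young_subgroup n l"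
  have perm: "permutation w" if "w \<in> sym_group n" for w
    using that permutes_imp_permutation[of "{1..n}" w] by simp
  have a': "a \<in> sym_group n"
    using a young_subgroup_subset by blast
  have sign: "of_int (sign u) = (of_int (sign a) :: rat)"
    if w: "w \<in> sym_group n" and u: "u \<in> sym_group n" and eq: "w = a \<circ> (w \<circ> u)" for w u
  proof -
    have "sign w = sign a * (sign w * sign u)"
      using eq perm[OF w] perm[OF u] perm[OF a'] by (metis permutation_compose sign_compose)
    then show ?thesis
      by (cases a rule: sign_cases; cases u rule: sign_cases; cases w rule: sign_cases) simp_all
  qed
  have len: "(-1) ^ coxeter_length n u = (of_int (sign u) :: rat)" if "u \<in> sym_group n" for u
    using sign_coxeter_length[OF that] by (metis of_int_1 of_int_minus of_int_power)
  let ?i = "\<lambda>w u. if w = a \<circ> (w \<circ> u) then 1 else 0 :: rat"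
  have "sign_count l a = (\<Sum>w\<in>sym_group n. \<Sum>u\<in>?Y. of_int (sign a) * (if w = a \<circ> (w \<circ> u) then 1 else 0))"
    unfolding sign_count_def
  proof (intro sum.cong refl)
    fix w u
    assume w: "w \<in> sym_group n" and "u \<in> ?Y"
    then have u: "u \<in> sym_group n"
      using young_subgroup_subset by blast
    show "(-1) ^ coxeter_length n u * (if w = a \<circ> (w \<circ> u) then 1 else 0)
        = (of_int (sign a) * (if w = a \<circ> (w \<circ> u) then 1 else 0) :: rat)"
    proof (cases "w = a \<circ> (w \<circ> u)")
      case True
      have "(-1) ^ coxeter_length n u = (of_int (sign a) :: rat)"
        using len[OF u] sign[OF w u True] by (rule trans)
      then show ?thesis
        by (simp only:)
    next
      case False
      then show ?thesis
        by (simp only: if_False mult_zero_right)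
    qed
  qed
  then have eq: "sign_count l a = of_int (sign a) * (\<Sum>w\<in>sym_group n. \<Sum>u\<in>?Y. ?i w u)"
    unfolding sum_distrib_left .
  have pos: "0 < (\<Sum>u\<in>?Y. if id = a \<circ> (id \<circ> u) then 1 else (0 :: rat))"
  proof (rule sum_pos2)
    have "id = a \<circ> (id \<circ> inv a)"
      using permutes_inv_o(1)[of a "{1..n}"] a' by simp
    then show "0 < (if id = a \<circ> (id \<circ> inv a) then 1 else (0 :: rat))"
      by (subst if_P, assumption) (rule zero_less_one)
  qed (use young_subgroup_inv[OF a] finite_young_subgroup in auto)
  have "0 < (\<Sum>w\<in>sym_group n. \<Sum>u\<in>?Y. ?i w u)"
  proof (rule sum_pos2[where i = id and f = "\<lambda>w. \<Sum>u\<in>?Y. ?i w u", OF finite_sym_group _ pos])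
    show "id \<in> sym_group n"
      using permutes_id by blast
  qed (rule sum_nonneg, simp)
  with eq show ?thesis
    by simp
qed

section \<open>Independence and joint surjectivity of the characters\<close>

lemma induced_sign_characters_independent:
  assumes "\<And>g. (\<Sum>l\<in>partitions n. a l * induced_sign_character l g) = 0" "k \<in> partitions n"
  shows "a k = 0"
proof (rule ccontr)
  assume "a k \<noteq> 0"
  \<comment> \<open>Dividing by the coefficient \<open>a p\<close> with the worst pole at 1 makes
    all coefficients regular there, without all values becoming zero.\<close>
  then obtain p where p: "p \<in> partitions n" "a p \<noteq> 0"
    "\<And>l. l \<in> partitions n \<Longrightarrow> \<exists>r. value_at_one (a l / a p) r"
    using dominant_coefficient[OF finite_partitions assms(2), of a] by blast
  then obtain r where r: "\<And>l. l \<in> partitions n \<Longrightarrow> value_at_one (a l / a p) (r l)"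
    by metis
  have "r p = 1"
    using value_at_one_unique[OF r[OF p(1)]] value_at_one_const(2) p(2) by simp
  \<comment> \<open>Among the partitions with nonzero value \<open>r\<close>, one of least length is
    taken. At \<open>block_cycle m\<close>, shorter partitions drop out because \<open>r\<close>
    vanishes, and all others except \<open>m\<close> because \<open>sign_count\<close> does.\<close>
  then obtain m where m: "m \<in> partitions n" "r m \<noteq> 0"
    "\<And>l. l \<in> partitions n \<Longrightarrow> r l \<noteq> 0 \<Longrightarrow> length m \<le> length l"
    using p(1) ex_has_least_nat[of "\<lambda>l. l \<in> partitions n \<and> r l \<noteq> 0" p length] by auto
  let ?v = "\<lambda>l. sign_count l (block_cycle m) / of_nat (card (young_subgroup n l))"
  have sum: "sum_list l = n" if "l \<in> partitions n" for l
    using that by (simp add: partitions_def)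
  note cycle = block_cycle_young_subgroup[OF sum[OF m(1)]]
  have "value_at_one (\<Sum>l\<in>partitions n. a l / a p * induced_sign_character l (T (block_cycle m)))
      (\<Sum>l\<in>partitions n. r l * ?v l)"
    by (intro value_at_one_sum value_at_one_mult r value_at_one_induced_sign_character sum)
      (use cycle young_subgroup_subset in blast)+
  moreover have "(\<Sum>l\<in>partitions n. a l / a p * induced_sign_character l (T (block_cycle m))) = 0"
  proof -
    have "(\<Sum>l\<in>partitions n. a l / a p * induced_sign_character l (T (block_cycle m)))
        = (\<Sum>l\<in>partitions n. a l * induced_sign_character l (T (block_cycle m))) / a p"
      by (simp add: sum_divide_distrib)
    then show ?thesis
      by (simp add: assms(1))
  qed
  ultimately have "(\<Sum>l\<in>partitions n. r l * ?v l) = 0"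
    using value_at_one_unique value_at_one_const(1) by metis
  moreover have "(\<Sum>l\<in>partitions n. r l * ?v l) = (\<Sum>l\<in>partitions n. if l = m then r l * ?v l else 0)"
  proof (rule sum.cong[OF refl])
    fix l
    assume "l \<in> partitions n"
    then show "r l * ?v l = (if l = m then r l * ?v l else 0)"
      using sign_count_eq_0[OF _ m(1)] m(3) by fastforce
  qed
  ultimately have "r m * ?v m = 0"
    using m(1) finite_partitions by simp
  then show False
    using m(2) sign_count_nonzero[OF cycle] card_young_subgroup_nonzero by simp
qed

text \<open>By duality, independence lets the characters take any prescribed family of values at a
  single element.\<close>

lemma induced_sign_characters_surjective: "\<exists>g. \<forall>l\<in>partitions n. induced_sign_character l g = b l"
proof (rule independent_functionals_surjective[OF vector_space_axioms finite_partitions])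
  fix l
  assume "l \<in> partitions n"
  then show "Vector_Spaces.linear scale (*) (induced_sign_character l)"
    by (intro linear_induced_sign_character) (simp add: partitions_def)
qed (fact induced_sign_characters_independent)

end

lemma of_Zq_0 [simp]: "of_Zq 0 = 0"
  by (simp add: of_Zq_def)

theorem proposition2p3:
  fixes n :: nat
    and scale :: "ratq \<Rightarrow> 'h::ring_1 \<Rightarrow> 'h"
    and T :: "(nat \<Rightarrow> nat) \<Rightarrow> 'h"
    and F :: "nat multiset \<Rightarrow> int poly"
  assumes "hecke_algebra scale n T"
    and "F \<in> symmetric_functions n"
  shows "\<exists>g. hecke_algebra.Y scale n T g = (\<lambda>M. of_Zq (F M))"
proof -
  interpret hecke_algebra scale n T by fact
  \<comment> \<open>Applying \<open>of_Zq\<close> to the coefficients preserves symmetry, and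
    \<open>of_Zq 0 = 0\<close> preserves homogeneity.\<close>
  have "(\<lambda>M. of_Zq (F M)) \<in> symmetric_functions n"
    using assms(2) by (simp add: symmetric_functions_def)
  then obtain b where b: "(\<lambda>M. of_Zq (F M)) = (\<lambda>M. \<Sum>l\<in>partitions n. b l * monomial_symmetric l M)"
    using symmetric_functions_expansion by blast
  obtain g where "\<forall>l\<in>partitions n. induced_sign_character l g = b l"
    using induced_sign_characters_surjective by blast
  then have "Y g = (\<lambda>M. \<Sum>l\<in>partitions n. b l * monomial_symmetric l M)"
    unfolding Y_def by (intro ext sum.cong) auto
  with b show ?thesis
    by metis
qed

end
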